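(* Let $(\mathbb{K},|\cdot|)$ be either $\mathbb{R}$ with the usual absolute value or an arbitrary ultrametric field. Let $E$ be a metrizable (Hausdorff) topological $\mathbb{K}$-vector space and let $U\subseteq E$ be a non-empty open subset. Then: (a) the topology on $U$ induced by $E$ coincides with the final topology on $U$ with respect to the set of all smooth curves $c\colon\mathbb{K}\to E$ with image in $U$; (b) a map $f\colon U\to Z$ into a topological space $Z$ is continuous if and only if $f\circ c\colon\mathbb{K}\to Z$ is continuous for every smooth curve $c\colon\mathbb{K}\to E$ with image in $U$.
   Context: An ultrametric field is a field with a non-trivial absolute value satisfying $|x+y|\le\max\{|x|,|y|\}$. Smoothness of a curve $c\colon\mathbb{K}\to E$ is in the following sense: for open $V$ in a topological $\mathbb{K}$-vector space $X$, set $V^{[1]}:=\{(x,v,t)\in V\times X\times\mathbb{K}: x+tv\in V\}$. A map $g\colon V\to Y$ into a topological $\mathbb{K}$-vector space is $C^0$ if continuous, and $C^1$ if continuous and there is a continuous $g^{[1]}\colon V^{[1]}\to Y$ with $g(x+tv)-g(x)=t\,g^{[1]}(x,v,t)$ on $V^{[1]}$; recursively $V^{[k+1]}:=(V^{[k]})^{[1]}$, $g$ is $C^{k+1}$ if $C^k$ and $g^{[k]}$ is $C^1$, with $g^{[k+1]}:=(g^{[k]})^{[1]}$; smooth means $C^k$ for all $k$. Products carry the product topology; all vector spaces are Hausdorff. *)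

theory Defs
  imports "HOL-Analysis.Analysis"
begin

definition abs_value :: "('k::field \<Rightarrow> real) \<Rightarrow> bool" where
  "abs_value av \<longleftrightarrow>
     (\<forall>x. av x \<ge> 0) \<and> (\<forall>x. av x = 0 \<longleftrightarrow> x = 0) \<and>
     (\<forall>x y. av (x * y) = av x * av y) \<and> (\<forall>x y. av (x + y) \<le> av x + av y)"

definition nontrivial_abs :: "('k::field \<Rightarrow> real) \<Rightarrow> bool" where
  "nontrivial_abs av \<longleftrightarrow> (\<exists>x. av x \<noteq> 0 \<and> av x \<noteq> 1)"

definition ultrametric_abs :: "('k::field \<Rightarrow> real) \<Rightarrow> bool" where
  "ultrametric_abs av \<longleftrightarrow> (\<forall>x y. av (x + y) \<le> max (av x) (av y))"

definition is_real_abs :: "('k::field \<Rightarrow> real) \<Rightarrow> bool" where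
  "is_real_abs av \<longleftrightarrow> (\<exists>\<phi> :: 'k \<Rightarrow> real. bij \<phi> \<and>
     (\<forall>x y. \<phi> (x + y) = \<phi> x + \<phi> y \<and> \<phi> (x * y) = \<phi> x * \<phi> y) \<and>
     (\<forall>x. av x = \<bar>\<phi> x\<bar>))"

definition abs_topology :: "('k::field \<Rightarrow> real) \<Rightarrow> 'k topology" where
  "abs_topology av = topology (\<lambda>U. \<forall>x\<in>U. \<exists>r>0. \<forall>y. av (y - x) < r \<longrightarrow> y \<in> U)"

definition tvs :: "('k::field \<Rightarrow> real) \<Rightarrow> ('k \<Rightarrow> 'e::ab_group_add \<Rightarrow> 'e) \<Rightarrow> 'e topology \<Rightarrow> bool" where
  "tvs av sm TE \<longleftrightarrow>
     (\<forall>a x y. sm a (x + y) = sm a x + sm a y) \<and>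
     (\<forall>a b x. sm (a + b) x = sm a x + sm b x) \<and>
     (\<forall>a b x. sm (a * b) x = sm a (sm b x)) \<and>
     (\<forall>x. sm 1 x = x) \<and>
     topspace TE = UNIV \<and>
     continuous_map (prod_topology TE TE) TE (\<lambda>(x, y). x + y) \<and>
     continuous_map (prod_topology (abs_topology av) TE) TE (\<lambda>(a, x). sm a x)"

section \<open>Smooth curves K \<rightarrow> E (Bertram--Gloeckner--Neeb differentiability)\<close>

text \<open>The iterated spaces K^{[k]} are finite powers of K; an element of K^n is
  encoded as an extensional function on {..<n}, with the product topology.
  An element (x,v,t) of K^n \<times> K^n \<times> K is encoded as a point of K^(2n+1):
  first n coordinates x, next n coordinates v, last coordinate t.\<close>

definition Kvec :: "nat \<Rightarrow> (nat \<Rightarrow> 'k) set" where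
  "Kvec n = PiE {..<n} (\<lambda>_. UNIV)"

definition Ktop :: "('k::field \<Rightarrow> real) \<Rightarrow> nat \<Rightarrow> (nat \<Rightarrow> 'k) topology" where
  "Ktop av n = product_topology (\<lambda>_. abs_topology av) {..<n}"

definition fstp :: "nat \<Rightarrow> (nat \<Rightarrow> 'k) \<Rightarrow> (nat \<Rightarrow> 'k)" where
  "fstp n w = restrict w {..<n}"

definition sndp :: "nat \<Rightarrow> (nat \<Rightarrow> 'k) \<Rightarrow> (nat \<Rightarrow> 'k)" where
  "sndp n w = restrict (\<lambda>i. w (n + i)) {..<n}"

definition lastp :: "nat \<Rightarrow> (nat \<Rightarrow> 'k) \<Rightarrow> 'k" where
  "lastp n w = w (2 * n)"

definition lin :: "nat \<Rightarrow> (nat \<Rightarrow> 'k::field) \<Rightarrow> 'k \<Rightarrow> (nat \<Rightarrow> 'k) \<Rightarrow> (nat \<Rightarrow> 'k)" where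
  "lin n x t v = restrict (\<lambda>i. x i + t * v i) {..<n}"

definition bracket :: "nat \<Rightarrow> (nat \<Rightarrow> 'k::field) set \<Rightarrow> (nat \<Rightarrow> 'k) set" where
  "bracket n V = {w \<in> Kvec (2 * n + 1). fstp n w \<in> V \<and> lin n (fstp n w) (lastp n w) (sndp n w) \<in> V}"

fun dimk :: "nat \<Rightarrow> nat" where
  "dimk 0 = 1"
| "dimk (Suc k) = 2 * dimk k + 1"

fun Kbr :: "nat \<Rightarrow> (nat \<Rightarrow> 'k::field) set" where
  "Kbr 0 = Kvec 1"
| "Kbr (Suc k) = bracket (dimk k) (Kbr k)"

definition is_dq :: "('k::field \<Rightarrow> real) \<Rightarrow> ('k \<Rightarrow> 'e::ab_group_add \<Rightarrow> 'e) \<Rightarrow> 'e topology \<Rightarrow>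
    nat \<Rightarrow> (nat \<Rightarrow> 'k) set \<Rightarrow> ((nat \<Rightarrow> 'k) \<Rightarrow> 'e) \<Rightarrow> ((nat \<Rightarrow> 'k) \<Rightarrow> 'e) \<Rightarrow> bool" where
  "is_dq av sm TE n V g h \<longleftrightarrow>
     continuous_map (subtopology (Ktop av (2 * n + 1)) (bracket n V)) TE h \<and>
     (\<forall>w \<in> bracket n V.
        g (lin n (fstp n w) (lastp n w) (sndp n w)) - g (fstp n w) = sm (lastp n w) (h w))"

definition curve_Ck :: "('k::field \<Rightarrow> real) \<Rightarrow> ('k \<Rightarrow> 'e::ab_group_add \<Rightarrow> 'e) \<Rightarrow> 'e topology \<Rightarrow>
    nat \<Rightarrow> ('k \<Rightarrow> 'e) \<Rightarrow> bool" where
  "curve_Ck av sm TE k c \<longleftrightarrow>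
     (\<exists>G :: nat \<Rightarrow> (nat \<Rightarrow> 'k) \<Rightarrow> 'e.
        (\<forall>w \<in> Kvec 1. G 0 w = c (w 0)) \<and>
        (\<forall>j\<le>k. continuous_map (subtopology (Ktop av (dimk j)) (Kbr j)) TE (G j)) \<and>
        (\<forall>j<k. is_dq av sm TE (dimk j) (Kbr j) (G j) (G (Suc j))))"

definition smooth_curve :: "('k::field \<Rightarrow> real) \<Rightarrow> ('k \<Rightarrow> 'e::ab_group_add \<Rightarrow> 'e) \<Rightarrow> 'e topology \<Rightarrow>
    ('k \<Rightarrow> 'e) \<Rightarrow> bool" where
  "smooth_curve av sm TE c \<longleftrightarrow> (\<forall>k. curve_Ck av sm TE k c)"

definition final_topology :: "'a topology \<Rightarrow> 'b set \<Rightarrow> ('a \<Rightarrow> 'b) set \<Rightarrow> 'b topology" where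
  "final_topology T S F =
     topology (\<lambda>A. A \<subseteq> S \<and> (\<forall>c\<in>F. openin T (c -` A \<inter> topspace T)))"

end

theory Submission
  imports Defs
begin

text \<open>
  Suppose that \<open>A \<subseteq> U\<close> has open preimages under all smooth curves in \<open>U\<close> but is not a neighbourhood
  of some \<open>x \<in> A\<close>. Fix \<open>0 < av \<pi> < 1\<close> and smooth scalar bumps \<open>h n\<close> with \<open>h n (\<pi> ^ n) = 1\<close>,
  supported near \<open>\<pi> ^ n\<close>. As \<open>E\<close> is metrizable, there are points \<open>z n \<notin> A\<close> tending to \<open>x\<close> as fast
  as desired, and then \<open>c s = x + (\<Sum>n. h n s (z n - x))\<close> is a smooth curve in \<open>U\<close> with \<open>c 0 = x\<close> and
  \<open>c (\<pi> ^ n) = z n\<close>, so the preimage of \<open>A\<close> is not a neighbourhood of \<open>0\<close>.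

  Smoothness is expressed by divided differences: a curve is smooth as soon as its divided
  differences extend to a symmetric family of continuous functions, because the iterated BGN
  difference quotients are then sums of divided differences at polynomial arguments with
  polynomial coefficients. For \<open>c\<close>, only finitely many summands contribute at each tuple of points,
  so the sum needs no completeness; speed of convergence is chosen against bounds of the divided
  differences of \<open>h n\<close> on bounded sets, and no local convexity is needed either.
\<close>

section \<open>Valued fields and topological vector spaces\<close>

text \<open>The BGN quotient of order k has 2^(k+1) - 1 scalar variables, so treating an infinite
  sum of curves directly would mean estimating all of these functions. A system of divided
  differences replaces them by one function on lists that carries all orders; sums, bounds and
  continuity are then handled on lists alone. Where arguments coincide nothing is divided: the
  values are forced by continuity, because a nontrivial absolute value leaves no isolated points.
  This yields symmetry and vanishing off the support for scalar systems. The speed of convergence is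
  a diagonal choice. No single scalar tames all orders and all bounded sets of arguments, so the
  n-th bump is scaled to be at most 1 only on lists of length at most n + 1 with entries of size at
  most n + 2; every bounded set of lists of one length is covered by all but finitely many n. Once
  the scale is divided out of \<open>z n - x\<close>, the remaining vector has to lie in the member
  with index n + 1 of a sequence of balanced neighbourhoods with
  \<open>V (Suc n) + V (Suc n)\<close> inside \<open>V n\<close>. This replaces absolute summability
  where convexity is missing.\<close>

locale valued_field =
  fixes av :: "'k::field \<Rightarrow> real"
  assumes abs_value: "abs_value av" and nontrivial: "nontrivial_abs av"
begin

lemma av_nonneg [simp]: "av x \<ge> 0"
  and av_eq_0 [simp]: "av x = 0 \<longleftrightarrow> x = 0"
  and av_mult: "av (x * y) = av x * av y"
  and av_triangle: "av (x + y) \<le> av x + av y"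
  using abs_value by (auto simp: abs_value_def)

lemma av_zero [simp]: "av 0 = 0"
  by simp

lemma av_pos [simp]: "av x > 0 \<longleftrightarrow> x \<noteq> 0"
  using av_nonneg[of x] av_eq_0[of x] by linarith

lemma av_one [simp]: "av 1 = 1"
  using av_mult[of 1 1] av_eq_0[of 1] by simp

lemma av_uminus [simp]: "av (- x) = av x"
proof -
  have "av (-1) * av (-1) = 1" using av_mult[of "-1" "-1"] by simp
  then have "av (-1) = 1"
    using av_nonneg[of "-1"] by (metis abs_of_nonneg abs_square_eq_1 power2_eq_square)
  then show ?thesis using av_mult[of "-1" x] by simp
qed

lemma av_diff_commute: "av (x - y) = av (y - x)"
  using av_uminus[of "x - y"] by simp

lemma av_power: "av (x ^ n) = av x ^ n"
  by (induction n) (auto simp: av_mult)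

lemma av_divide: "av (x / y) = av x / av y"
proof (cases "y = 0")
  case False
  then have "av (x / y) * av y = av x" using av_mult[of "x / y" y] by simp
  with False show ?thesis by (simp add: field_simps)
qed (simp add: av_eq_0)

lemma av_diff_triangle: "av (x - z) \<le> av (x - y) + av (y - z)"
  using av_triangle[of "x - y" "y - z"] by simp

lemma av_diff_le: "av (x - y) \<le> av x + av y"
  using av_triangle[of x "- y"] by simp

lemma ex_contraction: "\<exists>\<pi>. \<pi> \<noteq> 0 \<and> av \<pi> < 1"
proof -
  obtain x where x: "av x \<noteq> 0" "av x \<noteq> 1" using nontrivial by (auto simp: nontrivial_abs_def)
  show ?thesis
  proof (cases "av x < 1")
    case True then show ?thesis using x by auto
  next
    case False
    then have "av (1 / x) < 1" using x by (simp add: av_divide)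
    then show ?thesis using x by (intro exI[of _ "1 / x"]) auto
  qed
qed

lemma ex_small: assumes "\<epsilon> > 0" shows "\<exists>a. a \<noteq> 0 \<and> av a < \<epsilon>"
proof -
  obtain \<pi> where \<pi>: "\<pi> \<noteq> 0" "av \<pi> < 1" using ex_contraction by blast
  obtain n where "av \<pi> ^ n < \<epsilon>" using real_arch_pow_inv[OF assms \<pi>(2)] by blast
  then show ?thesis using \<pi> by (intro exI[of _ "\<pi> ^ n"]) (auto simp: av_power)
qed

lemma openin_abs_topology:
  "openin (abs_topology av) U \<longleftrightarrow> (\<forall>x\<in>U. \<exists>r>0. \<forall>y. av (y - x) < r \<longrightarrow> y \<in> U)"
proof -
  have "istopology (\<lambda>U. \<forall>x\<in>U. \<exists>r>0. \<forall>y. av (y - x) < r \<longrightarrow> y \<in> U)"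
    unfolding istopology_def
  proof (intro conjI allI impI ballI)
    fix S T x
    assume S: "\<forall>x\<in>S. \<exists>r>0. \<forall>y. av (y - x) < r \<longrightarrow> y \<in> S"
      and T: "\<forall>x\<in>T. \<exists>r>0. \<forall>y. av (y - x) < r \<longrightarrow> y \<in> T" and x: "x \<in> S \<inter> T"
    obtain r s where "r > 0" "\<forall>y. av (y - x) < r \<longrightarrow> y \<in> S" "s > 0" "\<forall>y. av (y - x) < s \<longrightarrow> y \<in> T"
      using S T x by blast
    then show "\<exists>r>0. \<forall>y. av (y - x) < r \<longrightarrow> y \<in> S \<inter> T"
      by (intro exI[of _ "min r s"]) auto
  next
    fix \<K> x
    assume \<K>: "\<forall>K\<in>\<K>. \<forall>x\<in>K. \<exists>r>0. \<forall>y. av (y - x) < r \<longrightarrow> y \<in> K" and "x \<in> \<Union>\<K>"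
    then obtain K where "K \<in> \<K>" "x \<in> K" by blast
    moreover from this obtain r where "r > 0" "\<forall>y. av (y - x) < r \<longrightarrow> y \<in> K" using \<K> by meson
    ultimately show "\<exists>r>0. \<forall>y. av (y - x) < r \<longrightarrow> y \<in> \<Union>\<K>" by auto
  qed
  then show ?thesis unfolding abs_topology_def by (subst topology_inverse') (assumption, rule refl)
qed

lemma topspace_abs_topology [simp]: "topspace (abs_topology av) = UNIV"
proof -
  have "openin (abs_topology av) UNIV"
    unfolding openin_abs_topology by (auto intro: exI[of _ 1])
  then show ?thesis using openin_subset by blast
qed

lemma openin_abs_ball: "openin (abs_topology av) {y. av (y - x) < r}"
  unfolding openin_abs_topology
proof clarify
  fix y assume y: "av (y - x) < r"
  have "av (z - x) < r" if "av (z - y) < r - av (y - x)" for z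
    using av_diff_triangle[of z x y] that by linarith
  moreover have "r - av (y - x) > 0" using y by simp
  ultimately show "\<exists>s>0. \<forall>z. av (z - y) < s \<longrightarrow> z \<in> {y. av (y - x) < r}"
    by blast
qed

lemma continuous_map_into_abs_topology:
  "continuous_map X (abs_topology av) f \<longleftrightarrow>
     (\<forall>x\<in>topspace X. \<forall>\<epsilon>>0. \<exists>O'. openin X O' \<and> x \<in> O' \<and> (\<forall>y\<in>O'. av (f y - f x) < \<epsilon>))"
  (is "_ \<longleftrightarrow> ?R")
proof
  assume f: "continuous_map X (abs_topology av) f"
  show ?R
  proof (intro ballI allI impI)
    fix x \<epsilon> assume x: "x \<in> topspace X" and \<epsilon>: "(\<epsilon>::real) > 0"
    have "openin X {y \<in> topspace X. f y \<in> {z. av (z - f x) < \<epsilon>}}"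
      by (rule openin_continuous_map_preimage[OF f openin_abs_ball])
    then show "\<exists>O'. openin X O' \<and> x \<in> O' \<and> (\<forall>y\<in>O'. av (f y - f x) < \<epsilon>)"
      using x \<epsilon> by (intro exI[of _ "{y \<in> topspace X. f y \<in> {z. av (z - f x) < \<epsilon>}}"]) auto
  qed
next
  assume R: ?R
  show "continuous_map X (abs_topology av) f"
    unfolding continuous_map_eq_topcontinuous_at topcontinuous_at_def
  proof (intro ballI conjI allI impI)
    fix x V assume x: "x \<in> topspace X" and V: "openin (abs_topology av) V \<and> f x \<in> V"
    then obtain r where "r > 0" and r: "\<forall>y. av (y - f x) < r \<longrightarrow> y \<in> V"
      unfolding openin_abs_topology by blast
    then show "\<exists>U. openin X U \<and> x \<in> U \<and> (\<forall>y\<in>U. f y \<in> V)" using R x by meson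
  qed auto
qed

lemma continuous_map_abs_add:
  assumes f: "continuous_map X (abs_topology av) f" and g: "continuous_map X (abs_topology av) g"
  shows "continuous_map X (abs_topology av) (\<lambda>x. f x + g x)"
  unfolding continuous_map_into_abs_topology
proof (intro ballI allI impI)
  fix x \<epsilon> assume x: "x \<in> topspace X" and \<epsilon>: "(\<epsilon>::real) > 0"
  obtain A where A: "openin X A" "x \<in> A" "\<forall>y\<in>A. av (f y - f x) < \<epsilon> / 2"
    using f x \<epsilon> unfolding continuous_map_into_abs_topology by (meson half_gt_zero)
  obtain B where B: "openin X B" "x \<in> B" "\<forall>y\<in>B. av (g y - g x) < \<epsilon> / 2"
    using g x \<epsilon> unfolding continuous_map_into_abs_topology by (meson half_gt_zero)
  show "\<exists>O'. openin X O' \<and> x \<in> O' \<and> (\<forall>y\<in>O'. av (f y + g y - (f x + g x)) < \<epsilon>)"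
  proof (intro exI conjI ballI)
    fix y assume "y \<in> A \<inter> B"
    then show "av (f y + g y - (f x + g x)) < \<epsilon>"
      using A B av_triangle[of "f y - f x" "g y - g x"] by (force simp: algebra_simps)
  qed (use A B in auto)
qed

lemma continuous_map_abs_mult:
  assumes f: "continuous_map X (abs_topology av) f" and g: "continuous_map X (abs_topology av) g"
  shows "continuous_map X (abs_topology av) (\<lambda>x. f x * g x)"
  unfolding continuous_map_into_abs_topology
proof (intro ballI allI impI)
  fix x \<epsilon> assume x: "x \<in> topspace X" and \<epsilon>: "(\<epsilon>::real) > 0"
  define M where "M = av (f x) + av (g x) + 1"
  have M: "M \<ge> 1" by (simp add: M_def)
  define \<delta> where "\<delta> = min 1 (\<epsilon> / (2 * M))"
  have \<delta>: "\<delta> > 0" "\<delta> \<le> 1" using M \<epsilon> by (auto simp: \<delta>_def)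
  have \<delta>M: "\<delta> * M \<le> \<epsilon> / 2"
  proof -
    have "\<delta> * M \<le> \<epsilon> / (2 * M) * M" using M by (intro mult_right_mono) (auto simp: \<delta>_def)
    then show ?thesis using M by simp
  qed
  obtain A where A: "openin X A" "x \<in> A" "\<forall>y\<in>A. av (f y - f x) < \<delta>"
    using f x \<delta> unfolding continuous_map_into_abs_topology by meson
  obtain B where B: "openin X B" "x \<in> B" "\<forall>y\<in>B. av (g y - g x) < \<delta>"
    using g x \<delta> unfolding continuous_map_into_abs_topology by meson
  show "\<exists>O'. openin X O' \<and> x \<in> O' \<and> (\<forall>y\<in>O'. av (f y * g y - f x * g x) < \<epsilon>)"
  proof (intro exI conjI ballI)
    fix y assume "y \<in> A \<inter> B"
    then have fy: "av (f y - f x) < \<delta>" and gy: "av (g y - g x) < \<delta>" using A B by auto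
    have gb: "av (g y) \<le> av (g x) + 1"
      using av_triangle[of "g y - g x" "g x"] gy \<delta> by simp
    have "f y * g y - f x * g x = (f y - f x) * g y + f x * (g y - g x)"
      by (simp add: algebra_simps)
    then have "av (f y * g y - f x * g x) \<le> av (f y - f x) * av (g y) + av (f x) * av (g y - g x)"
      using av_triangle av_mult by metis
    also have "\<dots> \<le> \<delta> * (av (g x) + 1) + av (f x) * \<delta>"
      using fy gy gb \<delta> by (intro add_mono mult_mono) auto
    also have "\<dots> = \<delta> * M" by (simp add: M_def algebra_simps)
    also have "\<dots> < \<epsilon>" using \<delta>M \<epsilon> by linarith
    finally show "av (f y * g y - f x * g x) < \<epsilon>" .
  qed (use A B in auto)
qed

end

locale valued_tvs = valued_field av for av :: "'k::field \<Rightarrow> real" +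
  fixes sm :: "'k \<Rightarrow> 'e::ab_group_add \<Rightarrow> 'e" and TE :: "'e topology"
  assumes tvs: "tvs av sm TE"
begin

lemma sm_add_right: "sm a (x + y) = sm a x + sm a y"
  and sm_add_left: "sm (a + b) x = sm a x + sm b x"
  and sm_mult: "sm (a * b) x = sm a (sm b x)"
  and sm_one [simp]: "sm 1 x = x"
  and topspace_TE [simp]: "topspace TE = UNIV"
  using tvs by (auto simp: tvs_def)

lemma sm_zero_right [simp]: "sm a 0 = 0"
  using sm_add_right[of a 0 0] by simp

lemma sm_zero_left [simp]: "sm 0 x = 0"
  using sm_add_left[of 0 0 x] by simp

lemma sm_diff_right: "sm a (x - y) = sm a x - sm a y"
  using sm_add_right[of a "x - y" y] by (simp add: algebra_simps)

lemma sm_diff_left: "sm (a - b) x = sm a x - sm b x"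
  using sm_add_left[of "a - b" b x] by (simp add: algebra_simps)

lemma sm_minus_left: "sm (- a) x = - sm a x"
  using sm_diff_left[of 0 a x] by simp

lemma sm_sum_right: "sm a (\<Sum>i\<in>S. f i) = (\<Sum>i\<in>S. sm a (f i))"
  by (induction S rule: infinite_finite_induct) (auto simp: sm_add_right)

lemma continuous_map_tvs_add:
  assumes "continuous_map X TE f" "continuous_map X TE g"
  shows "continuous_map X TE (\<lambda>x. f x + g x)"
proof -
  have "continuous_map X (prod_topology TE TE) (\<lambda>x. (f x, g x))"
    using assms by (simp add: continuous_map_paired)
  moreover have "continuous_map (prod_topology TE TE) TE (\<lambda>(x, y). x + y)"
    using tvs by (simp add: tvs_def)
  ultimately show ?thesis using continuous_map_compose by (fastforce simp: o_def)
qed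

lemma continuous_map_tvs_sm:
  assumes "continuous_map X (abs_topology av) a" "continuous_map X TE f"
  shows "continuous_map X TE (\<lambda>x. sm (a x) (f x))"
proof -
  have "continuous_map X (prod_topology (abs_topology av) TE) (\<lambda>x. (a x, f x))"
    using assms by (simp add: continuous_map_paired)
  moreover have "continuous_map (prod_topology (abs_topology av) TE) TE (\<lambda>(a, x). sm a x)"
    using tvs by (simp add: tvs_def)
  ultimately show ?thesis using continuous_map_compose by (fastforce simp: o_def)
qed

lemma openin_translate:
  assumes "openin TE W" shows "openin TE {x. u + x \<in> W}"
  using openin_continuous_map_preimage[OF continuous_map_tvs_add assms, of TE "\<lambda>x. u" "\<lambda>x. x"]
  by simp

lemma openin_dilate:
  assumes "openin TE W" shows "openin TE {x. sm a x \<in> W}"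
  using openin_continuous_map_preimage[OF continuous_map_tvs_sm assms, of TE "\<lambda>x. a" "\<lambda>x. x"]
  by simp

end

section \<open>Divided differences and smoothness\<close>

text \<open>A list of m + 1 nodes gets the divided difference of order m, so one function holds all
  orders of the curve given by its values on singletons. The relation is free of division and hence
  makes sense for x = y, where it says nothing and continuity has to decide.\<close>

definition dd_system :: "('k::field \<Rightarrow> 'e::ab_group_add \<Rightarrow> 'e) \<Rightarrow> ('k list \<Rightarrow> 'e) \<Rightarrow> bool" where
  "dd_system sm D \<longleftrightarrow> (\<forall>x y zs. D (x # zs) - D (y # zs) = sm (x - y) (D (x # y # zs)))"

text \<open>\<open>list_all2\<close> forces equal lengths, so this is continuity on each finite
  power of the field separately.\<close>

definition dd_continuous ::
    "('k::field \<Rightarrow> real) \<Rightarrow> 'e topology \<Rightarrow> ('k list \<Rightarrow> 'e) \<Rightarrow> bool" where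
  "dd_continuous av T D \<longleftrightarrow> (\<forall>xs W. openin T W \<and> D xs \<in> W \<longrightarrow>
     (\<exists>\<delta>>0. \<forall>ys. list_all2 (\<lambda>x y. av (y - x) < \<delta>) xs ys \<longrightarrow> D ys \<in> W))"

definition dd_symmetric :: "('k list \<Rightarrow> 'e) \<Rightarrow> bool" where
  "dd_symmetric D \<longleftrightarrow> (\<forall>us x y zs. D (us @ x # y # zs) = D (us @ y # x # zs))"

lemma dd_symmetric_move:
  assumes "dd_symmetric D" shows "D (x # us @ zs) = D (us @ x # zs)"
proof -
  have "D (vs @ x # us @ zs) = D (vs @ us @ x # zs)" for vs
  proof (induction us arbitrary: vs)
    case (Cons u us)
    have "D (vs @ x # u # us @ zs) = D (vs @ u # x # us @ zs)"
      using assms by (simp add: dd_symmetric_def)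
    also have "\<dots> = D (vs @ u # us @ x # zs)" using Cons[of "vs @ [u]"] by simp
    finally show ?case by simp
  qed simp
  from this[of "[]"] show ?thesis by simp
qed

section \<open>Polynomial functions on powers of the field and their difference quotients\<close>

inductive polyfun :: "nat \<Rightarrow> ((nat \<Rightarrow> 'k::field) \<Rightarrow> 'k) \<Rightarrow> bool" for n where
  const: "polyfun n (\<lambda>w. c)"
| coord: "i < n \<Longrightarrow> polyfun n (\<lambda>w. w i)"
| add: "polyfun n p \<Longrightarrow> polyfun n q \<Longrightarrow> polyfun n (\<lambda>w. p w + q w)"
| mult: "polyfun n p \<Longrightarrow> polyfun n q \<Longrightarrow> polyfun n (\<lambda>w. p w * q w)"

text \<open>If w encodes the triple (x, v, t), this is the point x + t v, while
  \<open>fstp n w\<close> is x; the BGN quotient compares the values at these two points.\<close>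

definition shiftp :: "nat \<Rightarrow> (nat \<Rightarrow> 'k::field) \<Rightarrow> nat \<Rightarrow> 'k" where
  "shiftp n w = lin n (fstp n w) (lastp n w) (sndp n w)"

lemma shiftp_apply: "i < n \<Longrightarrow> shiftp n w i = w i + w (2 * n) * w (n + i)"
  by (simp add: shiftp_def lin_def fstp_def sndp_def lastp_def)

lemma polyfun_fstp: "polyfun n p \<Longrightarrow> polyfun (2 * n + 1) (\<lambda>w. p (fstp n w))"
proof (induction rule: polyfun.induct)
  case (coord i)
  then show ?case using polyfun.coord[of i "2 * n + 1"] by (simp add: fstp_def)
qed (auto intro: polyfun.intros)

lemma polyfun_shiftp: "polyfun n p \<Longrightarrow> polyfun (2 * n + 1) (\<lambda>w. p (shiftp n w))"
proof (induction rule: polyfun.induct)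
  case (coord i)
  then show ?case by (auto simp: shiftp_apply intro!: polyfun.intros)
qed (auto intro: polyfun.intros)

text \<open>The factor t can be split off along the construction of p: a coordinate x_i has the
  quotient v_i, and products obey a Leibniz rule with one factor taken at x + t v and the other at
  x.\<close>

lemma polyfun_difference_quotient:
  "polyfun n p \<Longrightarrow> \<exists>q. polyfun (2 * n + 1) q \<and>
     (\<forall>w. p (shiftp n w) - p (fstp n w) = lastp n w * q w)"
proof (induction rule: polyfun.induct)
  case (const c)
  show ?case by (intro exI[of _ "\<lambda>w. 0"]) (auto intro: polyfun.const)
next
  case (coord i)
  then show ?case
    by (intro exI[of _ "\<lambda>w. w (n + i)"])
       (auto intro: polyfun.coord simp: shiftp_apply fstp_def lastp_def)
next
  case (add p q)
  then obtain p' q' where "polyfun (2 * n + 1) p'" "polyfun (2 * n + 1) q'"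
    "\<forall>w. p (shiftp n w) - p (fstp n w) = lastp n w * p' w"
    "\<forall>w. q (shiftp n w) - q (fstp n w) = lastp n w * q' w" by blast
  then show ?case
    by (intro exI[of _ "\<lambda>w. p' w + q' w"])
       (auto intro: polyfun.add simp: algebra_simps diff_eq_eq)
next
  case (mult p q)
  then obtain p' q' where p': "polyfun (2 * n + 1) p'" "polyfun (2 * n + 1) q'"
    and d: "\<And>w. p (shiftp n w) - p (fstp n w) = lastp n w * p' w"
    "\<And>w. q (shiftp n w) - q (fstp n w) = lastp n w * q' w" by blast
  have "p (shiftp n w) * q (shiftp n w) - p (fstp n w) * q (fstp n w) =
      lastp n w * (p' w * q (shiftp n w) + p (fstp n w) * q' w)" for w
  proof -
    have "p (shiftp n w) * q (shiftp n w) - p (fstp n w) * q (fstp n w) =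
      (p (shiftp n w) - p (fstp n w)) * q (shiftp n w)
      + p (fstp n w) * (q (shiftp n w) - q (fstp n w))" by (simp add: algebra_simps)
    then show ?thesis by (simp add: d algebra_simps)
  qed
  then show ?case using p' mult.hyps
    by (intro exI[of _ "\<lambda>w. p' w * q (shiftp n w) + p (fstp n w) * q' w"])
       (auto intro!: polyfun.add polyfun.mult polyfun_fstp[simplified] polyfun_shiftp[simplified])
qed

lemma (in valued_field) continuous_map_polyfun:
  "polyfun n p \<Longrightarrow> continuous_map (Ktop av n) (abs_topology av) p"
proof (induction rule: polyfun.induct)
  case (coord i)
  then show ?case unfolding Ktop_def by (intro continuous_map_product_projection) simp
qed (auto intro: continuous_map_abs_add continuous_map_abs_mult)

section \<open>BGN difference quotients of divided differences\<close>

context valued_tvs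
begin

text \<open>Functions of this shape are closed under BGN difference quotients, because a difference
  of divided differences telescopes into divided differences of the next order.\<close>

inductive dd_fun :: "('k list \<Rightarrow> 'e) \<Rightarrow> nat \<Rightarrow> ((nat \<Rightarrow> 'k) \<Rightarrow> 'e) \<Rightarrow> bool" for D n where
  zero: "dd_fun D n (\<lambda>w. 0)"
| base: "polyfun n p \<Longrightarrow> list_all (polyfun n) ls \<Longrightarrow>
    dd_fun D n (\<lambda>w. sm (p w) (D (map (\<lambda>l. l w) ls)))"
| add: "dd_fun D n f \<Longrightarrow> dd_fun D n g \<Longrightarrow> dd_fun D n (\<lambda>w. f w + g w)"

lemma continuous_map_dd_comp:
  assumes D: "dd_continuous av TE D"
    and ls: "list_all (\<lambda>l. continuous_map X (abs_topology av) l) ls"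
  shows "continuous_map X TE (\<lambda>w. D (map (\<lambda>l. l w) ls))"
  unfolding continuous_map_eq_topcontinuous_at topcontinuous_at_def
proof (intro ballI conjI allI impI)
  fix w V assume w: "w \<in> topspace X" and "openin TE V \<and> D (map (\<lambda>l. l w) ls) \<in> V"
  then obtain \<delta> where \<delta>: "\<delta> > 0"
    and V: "\<And>ys. list_all2 (\<lambda>x y. av (y - x) < \<delta>) (map (\<lambda>l. l w) ls) ys \<Longrightarrow> D ys \<in> V"
    using D unfolding dd_continuous_def by blast
  have "\<exists>O'. openin X O' \<and> w \<in> O' \<and> (\<forall>w'\<in>O'. \<forall>l\<in>set ls. av (l w' - l w) < \<delta>)"
    using ls
  proof (induction ls)
    case Nil then show ?case using w by auto
  next
    case (Cons l ls)
    then obtain A where A: "openin X A" "w \<in> A" "\<forall>w'\<in>A. \<forall>l\<in>set ls. av (l w' - l w) < \<delta>" by auto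
    obtain B where "openin X B" "w \<in> B" "\<forall>w'\<in>B. av (l w' - l w) < \<delta>"
      using Cons.prems w \<delta> unfolding continuous_map_into_abs_topology list_all_iff
      by (metis list.set_intros(1))
    then show ?case using A by (intro exI[of _ "A \<inter> B"]) auto
  qed
  then obtain O' where O': "openin X O'" "w \<in> O'" "\<forall>w'\<in>O'. \<forall>l\<in>set ls. av (l w' - l w) < \<delta>" by blast
  then show "\<exists>U. openin X U \<and> w \<in> U \<and> (\<forall>y\<in>U. D (map (\<lambda>l. l y) ls) \<in> V)"
    by (intro exI[of _ O']) (auto intro!: V simp: list_all2_conv_all_nth)
qed auto

lemma continuous_map_dd_fun:
  assumes "dd_fun D n f" and D: "dd_continuous av TE D"
  shows "continuous_map (Ktop av n) TE f"
  using assms(1)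
proof (induction rule: dd_fun.induct)
  case (base p ls)
  then show ?case
    by (intro continuous_map_tvs_sm continuous_map_polyfun continuous_map_dd_comp[OF D])
       (auto simp: list_all_iff intro: continuous_map_polyfun)
qed (auto intro: continuous_map_tvs_add)

lemma dd_fun_mult:
  assumes "dd_fun D n f" and p: "polyfun n p"
  shows "dd_fun D n (\<lambda>w. sm (p w) (f w))"
  using assms(1)
proof (induction rule: dd_fun.induct)
  case zero then show ?case by (simp add: dd_fun.zero)
next
  case (base q ls)
  then show ?case using dd_fun.base[of n "\<lambda>w. p w * q w" ls D] p
    by (simp add: sm_mult polyfun.mult)
next
  case (add f g)
  then show ?case by (simp add: sm_add_right dd_fun.add)
qed

text \<open>Arguments are switched one at a time. Switching the head from x to y costs y - x, which
  is t times a polynomial, times a divided difference containing both x and y. Afterwards x stands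
  on both sides and has to join the common entries \<open>rs\<close>; this needs symmetry and is the
  reason why the statement carries \<open>rs\<close>.\<close>

lemma dd_telescope:
  assumes D: "dd_system sm D" "dd_symmetric D"
    and ls: "list_all (polyfun n) ls" and rs: "list_all (polyfun (2 * n + 1)) rs"
  shows "\<exists>h. dd_fun D (2 * n + 1) h \<and>
    (\<forall>w. D (map (\<lambda>l. l (shiftp n w)) ls @ map (\<lambda>r. r w) rs)
       - D (map (\<lambda>l. l (fstp n w)) ls @ map (\<lambda>r. r w) rs) = sm (lastp n w) (h w))"
  using ls rs
proof (induction ls arbitrary: rs)
  case Nil
  show ?case by (intro exI[of _ "\<lambda>w. 0"]) (auto intro: dd_fun.zero)
next
  case (Cons l ls)
  then have l: "polyfun n l" and ls: "list_all (polyfun n) ls" by auto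
  let ?rs = "(\<lambda>w. l (fstp n w)) # rs"
  have rs': "list_all (polyfun (2 * n + 1)) ?rs" using Cons.prems l polyfun_fstp by auto
  from Cons.IH[OF ls rs'] obtain h where h: "dd_fun D (2 * n + 1) h"
    and h_eq: "\<And>w. D (map (\<lambda>l. l (shiftp n w)) ls @ map (\<lambda>r. r w) ?rs)
       - D (map (\<lambda>l. l (fstp n w)) ls @ map (\<lambda>r. r w) ?rs) = sm (lastp n w) (h w)" by blast
  obtain q where q: "polyfun (2 * n + 1) q"
    and q_eq: "\<And>w. l (shiftp n w) - l (fstp n w) = lastp n w * q w"
    using polyfun_difference_quotient[OF l] by blast
  let ?ls = "(\<lambda>w. l (shiftp n w)) # (\<lambda>w. l (fstp n w)) # map (\<lambda>l w. l (shiftp n w)) ls @ rs"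
  let ?f = "\<lambda>w. sm (q w) (D (map (\<lambda>l. l w) ?ls))"
  have "list_all (polyfun (2 * n + 1)) ?ls"
    using Cons.prems polyfun_shiftp polyfun_fstp by (auto simp: list_all_iff)
  then have f: "dd_fun D (2 * n + 1) ?f" by (intro dd_fun.base q)
  show ?case
  proof (intro exI[of _ "\<lambda>w. ?f w + h w"] conjI allI dd_fun.add f h)
    fix w
    let ?x = "l (fstp n w)" and ?y = "l (shiftp n w)"
      and ?xs = "map (\<lambda>l. l (fstp n w)) ls" and ?ys = "map (\<lambda>l. l (shiftp n w)) ls"
      and ?zs = "map (\<lambda>r. r w) rs"
    have "D (?y # ?ys @ ?zs) - D (?x # ?ys @ ?zs) = sm (?y - ?x) (D (?y # ?x # ?ys @ ?zs))"
      using D(1) by (simp add: dd_system_def)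
    also have "\<dots> = sm (lastp n w) (?f w)" by (simp add: q_eq sm_mult o_def)
    finally have 1: "D (?y # ?ys @ ?zs) - D (?x # ?ys @ ?zs) = sm (lastp n w) (?f w)" .
    have 2: "D (?x # ?ys @ ?zs) - D (?x # ?xs @ ?zs) = sm (lastp n w) (h w)"
      using h_eq[of w] dd_symmetric_move[OF D(2)] by simp
    have "D (?y # ?ys @ ?zs) - D (?x # ?xs @ ?zs) = sm (lastp n w) (?f w + h w)"
      unfolding sm_add_right 1[symmetric] 2[symmetric] by simp
    then show "D (map (\<lambda>l. l (shiftp n w)) (l # ls) @ map (\<lambda>r. r w) rs) -
       D (map (\<lambda>l. l (fstp n w)) (l # ls) @ map (\<lambda>r. r w) rs) = sm (lastp n w) (?f w + h w)"
      by simp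
  qed
qed

lemma dd_fun_difference_quotient:
  assumes "dd_fun D n f" and D: "dd_system sm D" "dd_symmetric D"
  shows "\<exists>h. dd_fun D (2 * n + 1) h \<and> (\<forall>w. f (shiftp n w) - f (fstp n w) = sm (lastp n w) (h w))"
  using assms(1)
proof (induction rule: dd_fun.induct)
  case zero
  show ?case by (intro exI[of _ "\<lambda>w. 0"]) (auto intro: dd_fun.zero)
next
  case (base p ls)
  obtain h where h: "dd_fun D (2 * n + 1) h"
    and h_eq: "\<And>w. D (map (\<lambda>l. l (shiftp n w)) ls) - D (map (\<lambda>l. l (fstp n w)) ls)
      = sm (lastp n w) (h w)"
    using dd_telescope[OF D base(2), of "[]"] by auto
  obtain q where q: "polyfun (2 * n + 1) q"
    and q_eq: "\<And>w. p (shiftp n w) - p (fstp n w) = lastp n w * q w"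
    using polyfun_difference_quotient[OF base(1)] by blast
  let ?f = "\<lambda>w. sm (q w) (D (map (\<lambda>l. l w) (map (\<lambda>l w. l (shiftp n w)) ls)))"
  have f: "dd_fun D (2 * n + 1) ?f"
    using base(2) polyfun_shiftp by (intro dd_fun.base q) (auto simp: list_all_iff)
  have g: "dd_fun D (2 * n + 1) (\<lambda>w. sm (p (fstp n w)) (h w))"
    by (intro dd_fun_mult h polyfun_fstp base)
  show ?case
  proof (intro exI[of _ "\<lambda>w. ?f w + sm (p (fstp n w)) (h w)"] conjI allI dd_fun.add f g)
    fix w
    let ?X = "D (map (\<lambda>l. l (fstp n w)) ls)" and ?Y = "D (map (\<lambda>l. l (shiftp n w)) ls)"
    have "sm (p (shiftp n w)) ?Y - sm (p (fstp n w)) ?X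
      = sm (p (shiftp n w) - p (fstp n w)) ?Y + sm (p (fstp n w)) (?Y - ?X)"
      by (simp add: sm_diff_left sm_diff_right)
    also have "\<dots> = sm (lastp n w) (sm (q w) ?Y) + sm (p (fstp n w)) (sm (lastp n w) (h w))"
      by (simp add: q_eq h_eq sm_mult)
    also have "sm (p (fstp n w)) (sm (lastp n w) (h w)) = sm (lastp n w) (sm (p (fstp n w)) (h w))"
      using sm_mult by (metis mult.commute)
    finally show "sm (p (shiftp n w)) ?Y - sm (p (fstp n w)) ?X
      = sm (lastp n w) (?f w + sm (p (fstp n w)) (h w))"
      by (simp add: sm_add_right o_def)
  qed
next
  case (add f g)
  then obtain f' g' where "dd_fun D (2 * n + 1) f'" "dd_fun D (2 * n + 1) g'"
    and d: "\<And>w. f (shiftp n w) - f (fstp n w) = sm (lastp n w) (f' w)"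
      "\<And>w. g (shiftp n w) - g (fstp n w) = sm (lastp n w) (g' w)" by blast
  then show ?case
    by (intro exI[of _ "\<lambda>w. f' w + g' w"] conjI allI dd_fun.add)
       (auto simp: sm_add_right d[symmetric])
qed

text \<open>The quotients are chosen recursively, with the shape \<open>dd_fun\<close> as invariant.
  Functions of this shape are defined and continuous on the whole power of the field and satisfy the
  quotient equation everywhere, so everything restricts to the sets \<open>Kbr j\<close>.\<close>

theorem smooth_curve_of_dd_system:
  assumes D: "dd_system sm D" "dd_symmetric D" "dd_continuous av TE D"
  shows "smooth_curve av sm TE (\<lambda>t. D [t])"
proof -
  have base: "dd_fun D (dimk 0) (\<lambda>w. D [w 0])"
    using dd_fun.base[of 1 "\<lambda>w. 1" "[\<lambda>w. w 0]" D] by (simp add: polyfun.intros)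
  have "\<exists>G. \<forall>j. (dd_fun D (dimk j) (G j) \<and> (j = 0 \<longrightarrow> G j = (\<lambda>w. D [w 0]))) \<and>
    (\<forall>w. G j (shiftp (dimk j) w) - G j (fstp (dimk j) w) = sm (lastp (dimk j) w) (G (Suc j) w))"
  proof (rule dependent_nat_choice)
    fix f :: "(nat \<Rightarrow> 'k) \<Rightarrow> 'e" and j
    assume "dd_fun D (dimk j) f \<and> (j = 0 \<longrightarrow> f = (\<lambda>w. D [w 0]))"
    then show "\<exists>h. (dd_fun D (dimk (Suc j)) h \<and> (Suc j = 0 \<longrightarrow> h = (\<lambda>w. D [w 0]))) \<and>
      (\<forall>w. f (shiftp (dimk j) w) - f (fstp (dimk j) w) = sm (lastp (dimk j) w) (h w))"
      using dd_fun_difference_quotient[OF _ D(1,2)] by auto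
  qed (use base in auto)
  then obtain G where G: "\<And>j. dd_fun D (dimk j) (G j)" and G0: "G 0 = (\<lambda>w. D [w 0])"
    and dq: "\<And>j w. G j (shiftp (dimk j) w) - G j (fstp (dimk j) w) = sm (lastp (dimk j) w) (G (Suc j) w)"
    by blast
  have cont: "continuous_map (subtopology (Ktop av (dimk j)) S) TE (G j)" for j S
    by (intro continuous_map_from_subtopology continuous_map_dd_fun[OF G D(3)])
  have "is_dq av sm TE (dimk j) (Kbr j) (G j) (G (Suc j))" for j
    unfolding is_dq_def using cont[of "Suc j"] dq by (auto simp: shiftp_def)
  then show ?thesis
    unfolding smooth_curve_def curve_Ck_def using cont G0 by (intro allI exI[of _ G]) auto
qed

lemma continuous_map_smooth_curve:
  assumes "smooth_curve av sm TE c" shows "continuous_map (abs_topology av) TE c"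
proof -
  obtain G where G0: "\<forall>w\<in>Kvec 1. G w = c (w 0)"
    and G: "continuous_map (subtopology (Ktop av 1) (Kvec 1)) TE G"
    using assms unfolding smooth_curve_def curve_Ck_def by (metis Kbr.simps(1) dimk.simps(1) le0)
  \<comment> \<open>This identifies the field with \<open>Kvec 1\<close>, so that c is recovered
    from the order 0 member of the smoothness data.\<close>
  let ?e = "\<lambda>t::'k. restrict (\<lambda>_. t) {..<1::nat}"
  have "continuous_map (abs_topology av) (Ktop av 1) ?e"
    unfolding Ktop_def continuous_map_componentwise by auto
  moreover have "?e t \<in> Kvec 1" for t :: 'k by (auto simp: Kvec_def)
  ultimately have "continuous_map (abs_topology av) (subtopology (Ktop av 1) (Kvec 1)) ?e"
    by (simp add: continuous_map_in_subtopology Pi_iff)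
  from continuous_map_compose[OF this G] have "continuous_map (abs_topology av) TE (G \<circ> ?e)" .
  moreover have "G \<circ> ?e = c" using G0 \<open>\<And>t. ?e t \<in> Kvec 1\<close> by (auto simp: fun_eq_iff)
  ultimately show ?thesis by simp
qed

end

section \<open>Scalar divided differences: density, symmetry and support\<close>

lemma finite_positive_lower_bound:
  fixes S :: "real set"
  assumes "finite S" "\<forall>s\<in>S. s > 0" shows "\<exists>\<eta>>0. \<forall>s\<in>S. \<eta> \<le> s"
  using assms
proof (induction rule: finite_induct)
  case empty then show ?case by (auto intro: exI[of _ 1])
next
  case (insert s S)
  then obtain \<eta> where "\<eta> > 0" "\<forall>s\<in>S. \<eta> \<le> s" by auto
  then show ?case using insert.prems by (intro exI[of _ "min \<eta> s"]) auto
qed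

context valued_field
begin

lemma dd_continuous_scalar_iff:
  "dd_continuous av (abs_topology av) D \<longleftrightarrow> (\<forall>xs. \<forall>\<epsilon>>0. \<exists>\<delta>>0. \<forall>ys.
     list_all2 (\<lambda>x y. av (y - x) < \<delta>) xs ys \<longrightarrow> av (D ys - D xs) < \<epsilon>)" (is "_ \<longleftrightarrow> ?R")
proof
  assume D: "dd_continuous av (abs_topology av) D"
  show ?R
  proof (intro allI impI)
    fix xs and \<epsilon> :: real assume "\<epsilon> > 0"
    then show "\<exists>\<delta>>0. \<forall>ys. list_all2 (\<lambda>x y. av (y - x) < \<delta>) xs ys \<longrightarrow> av (D ys - D xs) < \<epsilon>"
      using D[unfolded dd_continuous_def, rule_format, of "{z. av (z - D xs) < \<epsilon>}" xs]
        openin_abs_ball by simp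
  qed
next
  assume R: ?R
  show "dd_continuous av (abs_topology av) D"
    unfolding dd_continuous_def
  proof (intro allI impI)
    fix xs W assume "openin (abs_topology av) W \<and> D xs \<in> W"
    then obtain r where "r > 0" and r: "\<forall>y. av (y - D xs) < r \<longrightarrow> y \<in> W"
      unfolding openin_abs_topology by blast
    then obtain \<delta> where "\<delta> > 0"
      "\<forall>ys. list_all2 (\<lambda>x y. av (y - x) < \<delta>) xs ys \<longrightarrow> av (D ys - D xs) < r" using R by meson
    then show "\<exists>\<delta>>0. \<forall>ys. list_all2 (\<lambda>x y. av (y - x) < \<delta>) xs ys \<longrightarrow> D ys \<in> W"
      using r by meson
  qed
qed

text \<open>Nontriviality supplies nonzero \<open>a\<close> of arbitrarily small size; once
  \<open>a\<close> is smaller than the distance from x to every other point of F, the point x + a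
  avoids F.\<close>

lemma ex_near_avoiding_finite:
  assumes "\<delta> > 0" "finite F" shows "\<exists>u. u \<notin> F \<and> av (u - x) < \<delta>"
proof -
  have "\<exists>\<eta>>0. \<forall>s\<in>(\<lambda>f. av (f - x)) ` (F - {x}). \<eta> \<le> s"
    using assms by (intro finite_positive_lower_bound) auto
  then obtain \<eta> where \<eta>: "\<eta> > 0" "\<And>f. f \<in> F \<Longrightarrow> f \<noteq> x \<Longrightarrow> \<eta> \<le> av (f - x)" by auto
  obtain a where a: "a \<noteq> 0" "av a < min \<eta> \<delta>" using ex_small[of "min \<eta> \<delta>"] \<eta> assms by auto
  show ?thesis using a \<eta>(2)[of "x + a"] by (intro exI[of _ "x + a"]) force
qed

text \<open>Identities between divided differences come out multiplied by differences of nodes,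
  which cancel only if the first node avoids finitely many others. Continuity in the first node
  extends the identity to the excluded values.\<close>

lemma dd_eq_by_density:
  assumes D: "dd_continuous av (abs_topology av) D" "dd_continuous av (abs_topology av) D'"
    and "\<rho> > 0" "finite F"
    and eq: "\<And>u. u \<notin> F \<Longrightarrow> av (u - x) < \<rho> \<Longrightarrow> D (u # zs) = D' (u # ws)"
  shows "D (x # zs) = D' (x # ws)"
proof (rule ccontr)
  assume ne: "D (x # zs) \<noteq> D' (x # ws)"
  define \<epsilon> where "\<epsilon> = av (D (x # zs) - D' (x # ws)) / 2"
  have \<epsilon>: "\<epsilon> > 0" using ne by (simp add: \<epsilon>_def)
  obtain \<delta> where \<delta>: "\<delta> > 0"
    "\<And>ys. list_all2 (\<lambda>x y. av (y - x) < \<delta>) (x # zs) ys \<Longrightarrow> av (D ys - D (x # zs)) < \<epsilon>"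
    using D(1) \<epsilon> unfolding dd_continuous_scalar_iff by blast
  obtain \<delta>' where \<delta>': "\<delta>' > 0"
    "\<And>ys. list_all2 (\<lambda>x y. av (y - x) < \<delta>') (x # ws) ys \<Longrightarrow> av (D' ys - D' (x # ws)) < \<epsilon>"
    using D(2) \<epsilon> unfolding dd_continuous_scalar_iff by blast
  obtain u where u: "u \<notin> F" "av (u - x) < min \<rho> (min \<delta> \<delta>')"
    using ex_near_avoiding_finite[of "min \<rho> (min \<delta> \<delta>')" F x] \<open>\<rho> > 0\<close> \<open>finite F\<close> \<delta> \<delta>' by auto
  have "av (D (u # zs) - D (x # zs)) < \<epsilon>"
    using u \<delta>(1) by (intro \<delta>(2)) (simp add: list_all2_same)
  moreover have "av (D' (u # ws) - D' (x # ws)) < \<epsilon>"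
    using u \<delta>'(1) by (intro \<delta>'(2)) (simp add: list_all2_same)
  moreover have "D (u # zs) = D' (u # ws)" using eq u by simp
  ultimately have "av (D (x # zs) - D' (x # ws)) < \<epsilon> + \<epsilon>"
    using av_diff_triangle[of "D (x # zs)" "D' (x # ws)" "D (u # zs)"]
      av_diff_commute[of "D (x # zs)" "D (u # zs)"] by simp
  then show False by (simp add: \<epsilon>_def)
qed

text \<open>A swap of the two leading nodes follows by cancelling x - y. Behind one node u, both
  orders satisfy the same three-point formula. Behind at least two nodes, the recursion in the first
  two of them leads to lists with a shorter prefix, covered by induction. The last two cases cancel
  differences involving the first node and are completed by density. The scalar case suffices
  because series with vector coefficients inherit symmetry term by term.\<close>

lemma dd_symmetric_scalar:
  assumes D: "dd_system (*) D" "dd_continuous av (abs_topology av) D"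
  shows "dd_symmetric D"
proof -
  have rec: "(x - y) * D (x # y # zs) = D (x # zs) - D (y # zs)" for x y zs
    using D(1) by (simp add: dd_system_def)
  have swap: "D (x # y # zs) = D (y # x # zs)" for x y zs
  proof (cases "x = y")
    case False
    have "(x - y) * D (x # y # zs) = - ((y - x) * D (y # x # zs))" unfolding rec by simp
    also have "\<dots> = (x - y) * D (y # x # zs)" by (simp add: algebra_simps)
    finally have "(x - y) * D (x # y # zs) = (x - y) * D (y # x # zs)" .
    with False show ?thesis by simp
  qed simp
  have "D (us @ x # y # zs) = D (us @ y # x # zs)" for us x y zs
  proof (induction "length us" arbitrary: us)
    case 0 then show ?case using swap by simp
  next
    case (Suc n)
    then obtain a us' where us: "us = a # us'" "length us' = n" by (cases us) auto
    show ?case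
    proof (cases us')
      case Nil
      have "D (a # x # y # zs) = D (a # y # x # zs)" if "x \<noteq> y"
      proof (rule dd_eq_by_density[OF D(2) D(2), of 1 "{x, y}"])
        fix u assume u: "u \<notin> {x, y}"
        \<comment> \<open>Two expansions by the recursion remove all divided differences that
          contain two of u, x, y. For the other order the same right-hand side arises, after
          \<open>swap\<close> has put the inner pair y, x into the order x, y.\<close>
        have 1: "(u - x) * (u - y) * (x - y) * D (u # x # y # zs)
            = (x - y) * D (u # zs) - (u - y) * D (x # zs) + (u - x) * D (y # zs)"
        proof -
          have "(u - x) * (u - y) * (x - y) * D (u # x # y # zs)
            = (u - y) * (x - y) * ((u - x) * D (u # x # y # zs))" by (simp add: algebra_simps)
          also have "\<dots> = (x - y) * ((u - y) * D (u # y # zs)) - (u - y) * ((x - y) * D (x # y # zs))"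
            unfolding rec[of u x] by (simp add: algebra_simps)
          finally show ?thesis unfolding rec by (simp add: algebra_simps)
        qed
        have 2: "(u - x) * (u - y) * (x - y) * D (u # y # x # zs)
            = (x - y) * D (u # zs) - (u - y) * D (x # zs) + (u - x) * D (y # zs)"
        proof -
          have "(u - x) * (u - y) * (x - y) * D (u # y # x # zs)
            = (u - x) * (x - y) * ((u - y) * D (u # y # x # zs))" by (simp add: algebra_simps)
          also have "\<dots> = (x - y) * ((u - x) * D (u # x # zs)) - (u - x) * ((x - y) * D (x # y # zs))"
            unfolding rec[of u y] swap[of y x] by (simp add: algebra_simps)
          finally show ?thesis unfolding rec by (simp add: algebra_simps)
        qed
        have "(u - x) * (u - y) * (x - y) \<noteq> 0" using u that by simp
        then show "D (u # x # y # zs) = D (u # y # x # zs)"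
          using 1 2 by (metis mult_left_cancel)
      qed auto
      then show ?thesis using us Nil by auto
    next
      case (Cons b vs)
      have "D (a # b # vs @ x # y # zs) = D (a # b # vs @ y # x # zs)"
      proof (rule dd_eq_by_density[OF D(2) D(2), of 1 "{b}"])
        fix u assume u: "u \<notin> {b}"
        have "D (w # vs @ x # y # zs) = D (w # vs @ y # x # zs)" for w
          using Suc.hyps(1)[of "w # vs"] us Cons by simp
        then have "(u - b) * D (u # b # vs @ x # y # zs) = (u - b) * D (u # b # vs @ y # x # zs)"
          unfolding rec by simp
        then show "D (u # b # vs @ x # y # zs) = D (u # b # vs @ y # x # zs)" using u by simp
      qed auto
      then show ?thesis using us Cons by simp
    qed
  qed
  then show ?thesis by (simp add: dd_symmetric_def)
qed

text \<open>By induction both terms of the recursion vanish, so (u - y) times the divided difference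
  is 0, and density removes the factor. The strict inequality makes the outside of the ball open, so
  that u can be moved near x.\<close>

lemma dd_vanishes_off_support:
  assumes D: "dd_system (*) D" "dd_continuous av (abs_topology av) D" "D [] = 0"
    and supp: "\<And>x. av (x - t) > r \<Longrightarrow> D [x] = 0"
    and xs: "\<forall>x\<in>set xs. av (x - t) > r"
  shows "D xs = 0"
  using xs
proof (induction "length xs" arbitrary: xs)
  case 0 then show ?case using D(3) by simp
next
  case (Suc n)
  then obtain x ys where xs: "xs = x # ys" by (cases xs) auto
  show ?case
  proof (cases ys)
    case Nil then show ?thesis using Suc.prems xs supp by simp
  next
    case (Cons y zs)
    have "D (x # y # zs) = (\<lambda>_. 0) (x # y # zs)"
    \<comment> \<open>The radius is the distance by which x clears the ball: every u closer to x
      than this is still outside.\<close>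
    proof (rule dd_eq_by_density[OF D(2), of _ "av (x - t) - r" "{y}"])
      show "dd_continuous av (abs_topology av) (\<lambda>_. 0 :: 'k)"
        unfolding dd_continuous_scalar_iff by (auto intro: exI[of _ 1])
      fix u assume u: "u \<notin> {y}" "av (u - x) < av (x - t) - r"
      have "av (u - t) > r"
        using u(2) av_diff_triangle[of x t u] av_diff_commute[of x u] by simp
      then have "D (u # zs) = 0" "D (y # zs) = 0"
        using Suc.hyps(1)[of "u # zs"] Suc.hyps(1)[of "y # zs"] Suc.hyps(2) Suc.prems xs Cons by auto
      then have "(u - y) * D (u # y # zs) = 0" using D(1) by (metis dd_system_def diff_self)
      then show "D (u # y # zs) = 0" using u by simp
    qed (use Suc.prems xs in auto)
    then show ?thesis using xs Cons by simp
  qed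
qed

text \<open>As \<open>'k\<close> need not be locally compact, boundedness on bounded sets does not follow from
  continuity.\<close>

definition dd_bump :: "'k \<Rightarrow> real \<Rightarrow> ('k list \<Rightarrow> 'k) \<Rightarrow> bool" where
  "dd_bump t r D \<longleftrightarrow> dd_system (*) D \<and> dd_continuous av (abs_topology av) D \<and> D [] = 0 \<and> D [t] = 1 \<and>
     (\<forall>x. av (x - t) \<ge> r \<longrightarrow> D [x] = 0) \<and>
     (\<forall>n M. \<exists>C. \<forall>xs. length xs = n \<and> (\<forall>x\<in>set xs. av x \<le> M) \<longrightarrow> av (D xs) \<le> C)"

end

section \<open>Ultrametric bumps\<close>

text \<open>The divided difference over \<open>I @ J\<close> of a function that is \<open>1\<close> near the points of \<open>I\<close> and \<open>0\<close> near
  those of \<open>J\<close>; all recursive calls divide by differences of a point of \<open>I\<close> and one of \<open>J\<close> only.\<close>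

fun step_dd :: "'k::field list \<Rightarrow> 'k list \<Rightarrow> 'k" where
  "step_dd [] J = 0"
| "step_dd [x] [] = 1"
| "step_dd (x # y # I) [] = 0"
| "step_dd (x # I) (q # J) = (step_dd (x # I) J - step_dd I (q # J)) / (x - q)"

lemma step_dd_mult:
  "x \<noteq> q \<Longrightarrow> (x - q) * step_dd (x # I) (q # J) = step_dd (x # I) J - step_dd I (q # J)"
  by simp

declare step_dd.simps(4) [simp del]

text \<open>The recursion acts on the heads, while this relation concerns the last entries, so it
  passes through the recursion linearly: multiply by the difference a - q of the two heads, expand,
  use the hypotheses for the shorter J and for the shorter I, and cancel. The double induction
  reflects that either list may lose its head. The same scheme serves \<open>step_dd_outer\<close>
  and \<open>step_dd_crossing\<close>.\<close>

lemma step_dd_inner: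
  assumes "set (x # y # I) \<inter> set J = {}"
  shows "(x - y) * step_dd (I @ [x, y]) J = step_dd (I @ [x]) J - step_dd (I @ [y]) J"
  using assms
proof (induction J arbitrary: I)
  case Nil
  then show ?case by (cases I rule: remdups_adj.cases) auto
next
  case (Cons q J)
  note outer = Cons.IH
  show ?case using Cons.prems
  proof (induction I)
    case Nil
    then have q: "x \<noteq> q" "y \<noteq> q" by auto
    have "(x - y) * step_dd [x, y] J = step_dd [x] J - step_dd [y] J"
      by (rule outer[of "[]", unfolded append_Nil]) (use Nil.prems in auto)
    moreover have "(x - q) * step_dd [x] (q # J) = step_dd [x] J"
      "(y - q) * step_dd [y] (q # J) = step_dd [y] J"
      "(x - q) * step_dd [x, y] (q # J) = step_dd [x, y] J - step_dd [y] (q # J)"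
      using q by (auto simp: step_dd_mult)
    ultimately have "(x - q) * ((x - y) * step_dd [x, y] (q # J))
      = (x - q) * (step_dd [x] (q # J) - step_dd [y] (q # J))"
      by algebra
    then show ?case using q by simp
  next
    case (Cons a I)
    then have q: "a \<noteq> q" by auto
    have "(x - y) * step_dd (a # I @ [x, y]) J = step_dd (a # I @ [x]) J - step_dd (a # I @ [y]) J"
      by (rule outer[of "a # I", unfolded append_Cons]) (use Cons.prems in auto)
    moreover have "(x - y) * step_dd (I @ [x, y]) (q # J)
      = step_dd (I @ [x]) (q # J) - step_dd (I @ [y]) (q # J)"
      by (rule Cons.IH) (use Cons.prems in auto)
    ultimately have "(a - q) * ((x - y) * step_dd (a # I @ [x, y]) (q # J))
      = (a - q) * (step_dd (a # I @ [x]) (q # J) - step_dd (a # I @ [y]) (q # J))"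
      using step_dd_mult[OF q, of "I @ [x, y]" J] step_dd_mult[OF q, of "I @ [x]" J]
        step_dd_mult[OF q, of "I @ [y]" J] by algebra
    then show ?case using q by simp
  qed
qed

lemma step_dd_outer:
  assumes "set I \<inter> set (p # q # J) = {}"
  shows "(p - q) * step_dd I (J @ [p, q]) = step_dd I (J @ [p]) - step_dd I (J @ [q])"
  using assms
proof (induction I arbitrary: J)
  case Nil
  then show ?case by simp
next
  case (Cons x I)
  note outer = Cons.IH
  show ?case using Cons.prems
  proof (induction J)
    case Nil
    then have q: "x \<noteq> p" "x \<noteq> q" by auto
    have "(p - q) * step_dd I [p, q] = step_dd I [p] - step_dd I [q]" 
      by (rule outer[of "[]", unfolded append_Nil]) (use Nil.prems in auto)
    then have "(x - p) * ((p - q) * step_dd (x # I) [p, q])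
      = (x - p) * (step_dd (x # I) [p] - step_dd (x # I) [q])"
      using step_dd_mult[OF q(1), of I "[q]"] step_dd_mult[OF q(1), of I "[]"]
        step_dd_mult[OF q(2), of I "[]"] by algebra
    then show ?case using q by simp
  next
    case (Cons a J)
    then have q: "x \<noteq> a" by auto
    have "(p - q) * step_dd I (a # J @ [p, q]) = step_dd I (a # J @ [p]) - step_dd I (a # J @ [q])"
      by (rule outer[of "a # J", unfolded append_Cons]) (use Cons.prems in auto)
    moreover have "(p - q) * step_dd (x # I) (J @ [p, q])
      = step_dd (x # I) (J @ [p]) - step_dd (x # I) (J @ [q])"
      by (rule Cons.IH) (use Cons.prems in auto)
    ultimately have "(x - a) * ((p - q) * step_dd (x # I) (a # J @ [p, q]))
      = (x - a) * (step_dd (x # I) (a # J @ [p]) - step_dd (x # I) (a # J @ [q]))"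
      using step_dd_mult[OF q, of I "J @ [p, q]"] step_dd_mult[OF q, of I "J @ [p]"]
        step_dd_mult[OF q, of I "J @ [q]"] by algebra
    then show ?case using q by simp
  qed
qed

text \<open>Here \<open>step_dd [x] J\<close> is the product of the inverses of x - q over the
  entries q of J, so the position of a factor is immaterial.\<close>

lemma step_dd_singleton_snoc:
  assumes "x \<noteq> q" "x \<notin> set J"
  shows "(x - q) * step_dd [x] (J @ [q]) = step_dd [x] J"
  using assms(2)
proof (induction J)
  case Nil
  then show ?case using step_dd_mult[OF assms(1), of "[]" "[]"] by simp
next
  case (Cons p J)
  then have p: "x \<noteq> p" and IH: "(x - q) * step_dd [x] (J @ [q]) = step_dd [x] J" by auto
  have "(x - p) * step_dd [x] (p # J @ [q]) = step_dd [x] (J @ [q])"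
    "(x - p) * step_dd [x] (p # J) = step_dd [x] J"
    using p by (auto simp: step_dd_mult)
  with IH have "(x - p) * ((x - q) * step_dd [x] (p # J @ [q])) = (x - p) * step_dd [x] (p # J)"
    by (simp only: mult.left_commute[of "x - p"])
  then show ?case using p by simp
qed

text \<open>This is the defining recursion with last entries in place of heads, that is, the
  relation for a node inside the ball and a node outside it.\<close>

lemma step_dd_crossing:
  assumes "set (x # I) \<inter> set (q # J) = {}"
  shows "(x - q) * step_dd (I @ [x]) (J @ [q]) = step_dd (I @ [x]) J - step_dd I (J @ [q])"
  using assms
proof (induction I arbitrary: J)
  case Nil
  then have "x \<noteq> q" "x \<notin> set J" by auto
  then show ?case using step_dd_singleton_snoc[of x q J] by simp
next
  case (Cons a I)
  note outer = Cons.IH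
  show ?case using Cons.prems
  proof (induction J)
    case Nil
    then have q: "a \<noteq> q" by auto
    have "(x - q) * step_dd (I @ [x]) [q] = step_dd (I @ [x]) [] - step_dd I [q]"
      by (rule outer[of "[]", unfolded append_Nil]) (use Nil.prems in auto)
    \<comment> \<open>On an empty second list the value depends only on the length of the first: 1
      for length one and 0 otherwise.\<close>
    moreover have "step_dd (a # I) [] = step_dd (I @ [x]) []"
      by (cases I rule: remdups_adj.cases) auto
    moreover have 0: "step_dd (a # I @ [x]) [] = 0" by (cases I) auto
    ultimately have "(a - q) * ((x - q) * step_dd (a # I @ [x]) [q]) = (a - q) * (- step_dd (a # I) [q])"
      using step_dd_mult[OF q, of "I @ [x]" "[]"] step_dd_mult[OF q, of I "[]"] by algebra
    then have "(x - q) * step_dd (a # I @ [x]) [q] = - step_dd (a # I) [q]"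
      using q by (metis mult_left_cancel right_minus_eq)
    then show ?case using 0 by simp
  next
    case (Cons b J)
    then have q: "a \<noteq> b" by auto
    have "(x - q) * step_dd (I @ [x]) (b # J @ [q]) = step_dd (I @ [x]) (b # J) - step_dd I (b # J @ [q])"
      by (rule outer[of "b # J", unfolded append_Cons]) (use Cons.prems in auto)
    moreover have "(x - q) * step_dd (a # I @ [x]) (J @ [q])
      = step_dd (a # I @ [x]) J - step_dd (a # I) (J @ [q])"
      by (rule Cons.IH[unfolded append_Cons]) (use Cons.prems in auto)
    ultimately have "(a - b) * ((x - q) * step_dd (a # I @ [x]) (b # J @ [q]))
      = (a - b) * (step_dd (a # I @ [x]) (b # J) - step_dd (a # I) (b # J @ [q]))"
      using step_dd_mult[OF q, of "I @ [x]" "J @ [q]"] step_dd_mult[OF q, of "I @ [x]" J]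
        step_dd_mult[OF q, of I "J @ [q]"] by algebra
    then show ?case using q by simp
  qed
qed

lemma list_all2_filter:
  assumes "list_all2 P xs ys" "\<And>x y. P x y \<Longrightarrow> Q x = Q y"
  shows "list_all2 P (filter Q xs) (filter Q ys)"
  using assms(1)
proof (induction rule: list_all2_induct)
  case (Cons x xs y ys)
  then show ?case using assms(2)[of x y] by simp
qed simp

context valued_field
begin

definition separated :: "real \<Rightarrow> 'k list \<Rightarrow> 'k list \<Rightarrow> bool" where
  "separated r I J \<longleftrightarrow> (\<forall>x\<in>set I. \<forall>q\<in>set J. av (x - q) \<ge> r)"

lemma separated_Cons:
  "separated r (x # I) (q # J) \<Longrightarrow>
    av (x - q) \<ge> r \<and> separated r (x # I) J \<and> separated r I (q # J)"
  by (simp add: separated_def)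

abbreviation nearby :: "real \<Rightarrow> 'k list \<Rightarrow> 'k list \<Rightarrow> bool" where
  "nearby \<delta> \<equiv> list_all2 (\<lambda>x y. av (y - x) < \<delta>)"

lemma step_dd_bounded:
  assumes "r > 0"
  shows "\<exists>C\<ge>0. \<forall>I J. length I + length J = n \<and> separated r I J \<longrightarrow>
    av (step_dd I J) \<le> C"
proof (induction n)
  case 0
  show ?case by (intro exI[of _ 0]) auto
next
  case (Suc n)
  then obtain C where C: "C \<ge> 0" "\<And>I J. length I + length J = n \<Longrightarrow>
    separated r I J \<Longrightarrow> av (step_dd I J) \<le> C" by blast
  \<comment> \<open>The summand 1 covers the single node with value 1; in the recursion the
    numerator is at most 2 C and the denominator at least r. The size of the entries does not
    enter.\<close>
  have "av (step_dd I J) \<le> 1 + 2 * C / r"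
    if "length I + length J = Suc n" "separated r I J" for I J
  proof -
    have pos: "0 \<le> 2 * C / r" using C(1) assms by simp
    show ?thesis
    proof (cases "(I, J)" rule: step_dd.cases)
      case (4 x I' q J')
      have sep: "av (x - q) \<ge> r" "separated r (x # I') J'" "separated r I' (q # J')"
        using separated_Cons[of r x I' q J'] that 4 by auto
      have "av (step_dd (x # I') J') \<le> C" "av (step_dd I' (q # J')) \<le> C"
        by (rule C(2), use that 4 sep in simp, use sep in simp)+
      then have "av (step_dd (x # I') J' - step_dd I' (q # J')) \<le> 2 * C"
        using av_diff_triangle[of "step_dd (x # I') J'" "step_dd I' (q # J')" 0] by simp
      then have "av (step_dd I J) \<le> 2 * C / r"
        using sep 4 assms C(1) by (auto simp: step_dd.simps(4) av_divide intro!: frac_le)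
      then show ?thesis by simp
    qed (use pos in auto)
  qed
  then show ?case using C(1) assms by (intro exI[of _ "1 + 2 * C / r"]) auto
qed

lemma av_quotient_diff:
  assumes "av b \<ge> r" "av b' \<ge> r" "r > 0"
  shows "av (a' / b' - a / b) \<le> av (a' - a) / r + av a * av (b' - b) / (r * r)"
proof -
  have nz: "b \<noteq> 0" "b' \<noteq> 0" using assms by auto
  have "a' / b' - a / b = (a' - a) / b' + a * (b - b') / (b * b')"
    using nz by (simp add: field_simps)
  then have "av (a' / b' - a / b) \<le> av (a' - a) / av b' + av a * av (b' - b) / (av b * av b')"
    using av_triangle[of "(a' - a) / b'" "a * (b - b') / (b * b')"]
    by (simp add: av_divide av_mult av_diff_commute[of b b'])
  also have "\<dots> \<le> av (a' - a) / r + av a * av (b' - b) / (r * r)"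
    using assms by (intro add_mono frac_le mult_mono) auto
  finally show ?thesis .
qed

lemma step_dd_lipschitz:
  assumes r: "r > 0"
  shows "\<exists>L\<ge>0. \<forall>I J I' J' \<delta>. length I + length J = n \<and> \<delta> \<ge> 0 \<and>
    separated r I J \<and> separated r I' J' \<and>
    nearby \<delta> I I' \<and> nearby \<delta> J J' \<longrightarrow>
    av (step_dd I' J' - step_dd I J) \<le> L * \<delta>"
proof (induction n)
  case 0
  show ?case by (intro exI[of _ 0]) auto
next
  case (Suc n)
  then obtain L where L: "L \<ge> 0" "\<forall>I J I' J' \<delta>. length I + length J = n \<and> \<delta> \<ge> 0 \<and>
    separated r I J \<and> separated r I' J' \<and> nearby \<delta> I I' \<and> nearby \<delta> J J' \<longrightarrow>
    av (step_dd I' J' - step_dd I J) \<le> L * \<delta>" by (elim exE conjE) (rule that)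
  obtain C where C: "C \<ge> 0" "\<And>I J. length I + length J = n \<Longrightarrow>
    separated r I J \<Longrightarrow> av (step_dd I J) \<le> C"
    using step_dd_bounded[OF r, of n] by blast
  \<comment> \<open>The first term is the change of the numerator, 2 L \<delta>, over r. The second
    is the size 2 C of the numerator times the change 2 \<delta> of the denominator, over r
    squared.\<close>
  define L' where "L' = 2 * L / r + 4 * C / (r * r)"
  have L': "L' \<ge> 0" using L(1) C(1) r by (simp add: L'_def)
  have "av (step_dd I' J' - step_dd I J) \<le> L' * \<delta>"
    if len: "length I + length J = Suc n" and \<delta>: "\<delta> \<ge> 0"
      and sep: "separated r I J" "separated r I' J'"
      and I: "nearby \<delta> I I'" and J: "nearby \<delta> J J'"
    for I J I' J' \<delta>
  proof (cases "(I, J)" rule: step_dd.cases)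
    case (4 x I\<^sub>1 q J\<^sub>1)
    obtain x' I\<^sub>1' where I': "I' = x' # I\<^sub>1'" "av (x' - x) < \<delta>" "nearby \<delta> I\<^sub>1 I\<^sub>1'"
      using I 4 by (auto simp: list_all2_Cons1)
    obtain q' J\<^sub>1' where J': "J' = q' # J\<^sub>1'" "av (q' - q) < \<delta>" "nearby \<delta> J\<^sub>1 J\<^sub>1'"
      using J 4 by (auto simp: list_all2_Cons1)
    let ?a1 = "step_dd (x # I\<^sub>1) J\<^sub>1" and ?a2 = "step_dd I\<^sub>1 (q # J\<^sub>1)"
    let ?b1 = "step_dd (x' # I\<^sub>1') J\<^sub>1'" and ?b2 = "step_dd I\<^sub>1' (q' # J\<^sub>1')"
    have sep1: "av (x - q) \<ge> r" "separated r (x # I\<^sub>1) J\<^sub>1" "separated r I\<^sub>1 (q # J\<^sub>1)"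
      using separated_Cons[of r x I\<^sub>1 q J\<^sub>1] sep(1) 4 by auto
    have sep2: "av (x' - q') \<ge> r" "separated r (x' # I\<^sub>1') J\<^sub>1'" "separated r I\<^sub>1' (q' # J\<^sub>1')"
      using separated_Cons[of r x' I\<^sub>1' q' J\<^sub>1'] sep(2) I' J' by auto
    have 1: "av (?b1 - ?a1) \<le> L * \<delta>"
      by (rule L(2)[rule_format]) (use len \<delta> sep1 sep2 I' J' 4 in auto)
    have 2: "av (?b2 - ?a2) \<le> L * \<delta>"
      by (rule L(2)[rule_format]) (use len \<delta> sep1 sep2 I' J' 4 in auto)
    have "av ((?b1 - ?b2) - (?a1 - ?a2)) = av ((?b1 - ?a1) - (?b2 - ?a2))"
      by (simp add: algebra_simps)
    then have num: "av ((?b1 - ?b2) - (?a1 - ?a2)) \<le> 2 * L * \<delta>"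
      using av_diff_le[of "?b1 - ?a1" "?b2 - ?a2"] 1 2 by simp
    have "av ?a1 \<le> C" "av ?a2 \<le> C"
      by (rule C(2), use len 4 in simp, use sep1 in simp)+
    then have bd: "av (?a1 - ?a2) \<le> 2 * C" using av_diff_le[of ?a1 ?a2] by simp
    have "av ((x' - q') - (x - q)) = av ((x' - x) - (q' - q))" by (simp add: algebra_simps)
    then have den: "av ((x' - q') - (x - q)) \<le> 2 * \<delta>"
      using av_diff_le[of "x' - x" "q' - q"] I' J' by simp
    from av_quotient_diff[OF sep1(1) sep2(1) r, of "?b1 - ?b2" "?a1 - ?a2"]
    have "av (step_dd I' J' - step_dd I J) \<le>
      av ((?b1 - ?b2) - (?a1 - ?a2)) / r + av (?a1 - ?a2) * av ((x' - q') - (x - q)) / (r * r)"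
      using 4 I' J' by (simp add: step_dd.simps(4))
    also have "\<dots> \<le> (2 * L * \<delta>) / r + (2 * C) * (2 * \<delta>) / (r * r)"
      using num bd den r C(1) by (intro add_mono divide_right_mono mult_mono) auto
    also have "\<dots> = L' * \<delta>" by (simp add: L'_def algebra_simps)
    finally show ?thesis .
  next
    case (2 x)
    then show ?thesis using I J L' \<delta> by (auto simp: list_all2_Cons1)
  next
    case (3 x y I\<^sub>1)
    then show ?thesis using I J L' \<delta> by (auto simp: list_all2_Cons1)
  qed (use I L' \<delta> in auto)
  then show ?case using L' by (intro exI[of _ L']) auto
qed

text \<open>The bump is the indicator function of the ball. By the ultrametric inequality a point
  inside and a point outside are at distance at least r, so \<open>step_dd\<close> never divides by
  anything small and the estimates are uniform over all lists of a given length.\<close>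

lemma ultrametric_dd_bump:
  assumes ultra: "ultrametric_abs av" and r: "r > 0"
  shows "\<exists>D. dd_bump t r D"
proof -
  define B where "B = (\<lambda>x. av (x - t) < r)"
  \<comment> \<open>With \<open>rev\<close>, nodes added at the front of the list land at the end of
    I or J, where the three relations for \<open>step_dd\<close> apply.\<close>
  define I where "I = (\<lambda>xs. filter B (rev xs))"
  define J where "J = (\<lambda>xs. filter (\<lambda>x. \<not> B x) (rev xs))"
  define D where "D = (\<lambda>xs. step_dd (I xs) (J xs))"
  have um: "av (x - z) \<le> max (av (x - y)) (av (y - z))" for x y z
    using ultra[unfolded ultrametric_abs_def, rule_format, of "x - y" "y - z"] by simp
  have sep: "av (x - q) \<ge> r" if "B x" "\<not> B q" for x q
    using that um[of q t x] by (auto simp: B_def av_diff_commute)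
  have sepIJ: "separated r (I xs) (J xs)" for xs
    using sep by (auto simp: I_def J_def separated_def)
  have len: "length (I xs) + length (J xs) = length xs" for xs
    using sum_length_filter_compl[of B "rev xs"] by (simp add: I_def J_def)
  have sys: "dd_system (*) D"
    unfolding dd_system_def
  proof (intro allI)
    fix x y :: 'k and zs
    let ?I = "I zs" and ?J = "J zs"
    have disj: "set ?I \<inter> set ?J = {}" by (auto simp: I_def J_def)
    \<comment> \<open>Reversal turns the leading nodes x, y into a final pair y, x, so the relations
      arrive with the opposite sign on both sides.\<close>
    have flip: "q - p = (x - y) * d" if "(y - x) * d = p - q" for d p q :: 'k
    proof -
      have "(x - y) * d = - ((y - x) * d)" by (simp add: algebra_simps)
      then show ?thesis using that by simp
    qed
    have I_Cons: "I (u # us) = I us @ (if B u then [u] else [])"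
      and J_Cons: "J (u # us) = J us @ (if B u then [] else [u])" for u us
      by (simp_all add: I_def J_def)
    have out: "u \<notin> set ?J" if "B u" for u using that by (auto simp: J_def)
    have in': "u \<notin> set ?I" if "\<not> B u" for u using that by (auto simp: I_def)
    consider "B x" "B y" | "\<not> B x" "\<not> B y" | "B x" "\<not> B y" | "\<not> B x" "B y" by blast
    then show "D (x # zs) - D (y # zs) = (x - y) * D (x # y # zs)"
    proof cases
      case 1
      have "(y - x) * step_dd (?I @ [y, x]) ?J = step_dd (?I @ [y]) ?J - step_dd (?I @ [x]) ?J"
        by (rule step_dd_inner) (use 1 disj out in auto)
      from flip[OF this] 1 show ?thesis by (simp add: D_def I_Cons J_Cons)
    next
      case 2
      have "(y - x) * step_dd ?I (?J @ [y, x]) = step_dd ?I (?J @ [y]) - step_dd ?I (?J @ [x])"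
        by (rule step_dd_outer) (use 2 disj in' in auto)
      from flip[OF this] 2 show ?thesis by (simp add: D_def I_Cons J_Cons)
    next
      case 3
      have "(x - y) * step_dd (?I @ [x]) (?J @ [y]) = step_dd (?I @ [x]) ?J - step_dd ?I (?J @ [y])"
        by (rule step_dd_crossing) (use 3 disj in' out in auto)
      with 3 show ?thesis by (simp add: D_def I_Cons J_Cons)
    next
      case 4
      have "(y - x) * step_dd (?I @ [y]) (?J @ [x]) = step_dd (?I @ [y]) ?J - step_dd ?I (?J @ [x])"
        by (rule step_dd_crossing) (use 4 disj in' out in auto)
      from flip[OF this] 4 show ?thesis by (simp add: D_def I_Cons J_Cons)
    qed
  qed
  have cont: "dd_continuous av (abs_topology av) D"
    unfolding dd_continuous_scalar_iff
  proof (intro allI impI)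
    fix xs :: "'k list" and \<epsilon> :: real assume \<epsilon>: "\<epsilon> > 0"
    obtain L where L: "L \<ge> 0" "\<forall>I J I' J' \<delta>. length I + length J = length xs \<and> \<delta> \<ge> 0 \<and>
      separated r I J \<and> separated r I' J' \<and> nearby \<delta> I I' \<and> nearby \<delta> J J' \<longrightarrow>
      av (step_dd I' J' - step_dd I J) \<le> L * \<delta>"
      using step_dd_lipschitz[OF r, of "length xs"] by (elim exE conjE) (rule that)
    \<comment> \<open>The bound r keeps each node on its side of the ball, so the splitting into I
      and J does not change; L + 1 in the denominator allows for L = 0.\<close>
    define \<delta> where "\<delta> = min r (\<epsilon> / (L + 1))"
    have \<delta>: "\<delta> > 0" "\<delta> \<le> r" using r \<epsilon> L by (auto simp: \<delta>_def)
    have "L * \<delta> < (L + 1) * \<delta>" using \<delta> by simp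
    also have "\<dots> \<le> (L + 1) * (\<epsilon> / (L + 1))" using L by (intro mult_left_mono) (auto simp: \<delta>_def)
    also have "\<dots> = \<epsilon>" using L by simp
    finally have L\<delta>: "L * \<delta> < \<epsilon>" .
    show "\<exists>\<delta>>0. \<forall>ys. nearby \<delta> xs ys \<longrightarrow> av (D ys - D xs) < \<epsilon>"
    proof (intro exI[of _ \<delta>] conjI allI impI \<delta>(1))
      fix ys assume "nearby \<delta> xs ys"
      then have rev: "nearby \<delta> (rev xs) (rev ys)" by simp
      have same: "B x = B y" if "av (y - x) < \<delta>" for x y
        using that \<delta> um[of x t y] um[of y t x] by (auto simp: B_def av_diff_commute)
      have "nearby \<delta> (I xs) (I ys)"
        unfolding I_def by (rule list_all2_filter[OF rev same])
      moreover have "nearby \<delta> (J xs) (J ys)"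
        unfolding J_def using same by (intro list_all2_filter[OF rev]) auto
      ultimately have "av (D ys - D xs) \<le> L * \<delta>"
        unfolding D_def using \<delta> sepIJ len by (intro L(2)[rule_format]) auto
      then show "av (D ys - D xs) < \<epsilon>" using L\<delta> by simp
    qed
  qed
  have "\<exists>C. \<forall>xs. length xs = n \<and> (\<forall>x\<in>set xs. av x \<le> M) \<longrightarrow> av (D xs) \<le> C" for n M
  proof -
    obtain C where "\<And>I J. length I + length J = n \<Longrightarrow> separated r I J \<Longrightarrow> av (step_dd I J) \<le> C"
      using step_dd_bounded[OF r, of n] by blast
    then show ?thesis unfolding D_def using sepIJ len by (intro exI[of _ C]) simp
  qed
  moreover have "D [] = 0" "D [t] = 1" "\<forall>x. av (x - t) \<ge> r \<longrightarrow> D [x] = 0"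
    using r by (auto simp: D_def I_def J_def B_def)
  ultimately have "dd_bump t r D" unfolding dd_bump_def using sys cont by blast
  then show ?thesis by blast
qed

end

section \<open>Real bumps\<close>

text \<open>The Genocchi--Hermite formula: for a \<open>k\<close> times continuously differentiable \<open>f\<close>, the divided
  difference of \<open>f\<close> over \<open>k + 1\<close> points is the integral of the \<open>k\<close>-th derivative \<open>g\<close> over the simplex
  spanned by them. The simplex is parametrised here as a cone with apex \<open>z\<close>.\<close>

function simplex_integral :: "(real \<Rightarrow> real) \<Rightarrow> real list \<Rightarrow> real" where
  "simplex_integral g [] = 0"
| "simplex_integral g [x] = g x"
| "simplex_integral g (z # x # xs) =
     integral {0..1} (\<lambda>s. s ^ length xs * simplex_integral g (map (\<lambda>u. s * u + (1 - s) * z) (x # xs)))"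
  by pat_completeness auto
termination by (relation "Wellfounded.measure (\<lambda>(g, xs). length xs)") auto

text \<open>The weight is the Jacobian of the cone: its slice at parameter s is the simplex over
  \<open>xs\<close>, of dimension \<open>length xs - 1\<close>, scaled by s.\<close>

lemma simplex_integral_Cons:
  "xs \<noteq> [] \<Longrightarrow> simplex_integral g (z # xs) =
     integral {0..1} (\<lambda>s. s ^ (length xs - 1) * simplex_integral g (map (\<lambda>u. s * u + (1 - s) * z) xs))"
  by (cases xs) auto

declare simplex_integral.simps(3) [simp del]

lemma convex_combination_abs_le:
  fixes u z :: real
  assumes "\<bar>u\<bar> \<le> M" "\<bar>z\<bar> \<le> M" "s \<in> {0..1}" shows "\<bar>s * u + (1 - s) * z\<bar> \<le> M"
proof -
  have "\<bar>s * u + (1 - s) * z\<bar> \<le> s * \<bar>u\<bar> + (1 - s) * \<bar>z\<bar>"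
    using assms(3) by (intro order_trans[OF abs_triangle_ineq]) (auto simp: abs_mult)
  also have "\<dots> \<le> s * M + (1 - s) * M"
    using assms by (intro add_mono mult_left_mono) auto
  finally show ?thesis by (simp add: algebra_simps)
qed

text \<open>Uniformity over bounded lists is what an induction on the length can use, since the
  integrand runs through a whole family of lists, one for each s. The non-strict bound survives
  integration.\<close>

definition equicont_at_length :: "(real \<Rightarrow> real) \<Rightarrow> nat \<Rightarrow> bool" where
  "equicont_at_length g n \<longleftrightarrow> (\<forall>M. \<forall>\<epsilon>>0. \<exists>\<delta>>0. \<forall>xs ys. length xs = n \<longrightarrow>
     (\<forall>x\<in>set xs \<union> set ys. \<bar>x\<bar> \<le> M) \<longrightarrow> list_all2 (\<lambda>x y. \<bar>y - x\<bar> < \<delta>) xs ys \<longrightarrow>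
     \<bar>simplex_integral g ys - simplex_integral g xs\<bar> \<le> \<epsilon>)"

lemma equicont_at_lengthD:
  assumes "equicont_at_length g n" "\<epsilon> > 0"
  obtains \<delta> where "\<delta> > 0" "\<And>xs ys. length xs = n \<Longrightarrow> \<forall>x\<in>set xs \<union> set ys. \<bar>x\<bar> \<le> M \<Longrightarrow>
     list_all2 (\<lambda>x y. \<bar>y - x\<bar> < \<delta>) xs ys \<Longrightarrow> \<bar>simplex_integral g ys - simplex_integral g xs\<bar> \<le> \<epsilon>"
  using assms unfolding equicont_at_length_def by metis

lemma continuous_on_cone_integrand:
  assumes "equicont_at_length g (length xs)"
  shows "continuous_on {0..1} (\<lambda>s. simplex_integral g (map (\<lambda>u. s * u + (1 - s) * z) xs))"
  unfolding continuous_on_iff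
proof (intro ballI allI impI)
  fix s \<epsilon> :: real assume s: "s \<in> {0..1}" and \<epsilon>: "\<epsilon> > 0"
  define M where "M = \<bar>z\<bar> + sum_list (map abs xs)"
  have M: "\<bar>z\<bar> \<le> M" "\<And>u. u \<in> set xs \<Longrightarrow> \<bar>u\<bar> \<le> M"
    using member_le_sum_list[of _ "map abs xs"] sum_list_nonneg[of "map abs xs"]
    by (fastforce simp: M_def)+
  have M0: "M \<ge> 0" using M(1) by linarith
  obtain \<delta> where \<delta>: "\<delta> > 0" "\<And>us ys. length us = length xs \<Longrightarrow> \<forall>x\<in>set us \<union> set ys. \<bar>x\<bar> \<le> M \<Longrightarrow>
     list_all2 (\<lambda>x y. \<bar>y - x\<bar> < \<delta>) us ys \<Longrightarrow> \<bar>simplex_integral g ys - simplex_integral g us\<bar> \<le> \<epsilon> / 2"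
    using equicont_at_lengthD[OF assms, of "\<epsilon> / 2" M] \<epsilon> by auto
  \<comment> \<open>Moving s by d moves the node belonging to u by d times |u - z|, which is at most
    d (2 M + 1); the 1 keeps the denominator positive.\<close>
  define \<eta> where "\<eta> = \<delta> / (2 * M + 1)"
  have \<eta>: "\<eta> > 0" using \<delta> M0 by (simp add: \<eta>_def)
  show "\<exists>d>0. \<forall>s'\<in>{0..1}. dist s' s < d \<longrightarrow>
    dist (simplex_integral g (map (\<lambda>u. s' * u + (1 - s') * z) xs))
      (simplex_integral g (map (\<lambda>u. s * u + (1 - s) * z) xs)) < \<epsilon>"
  proof (intro exI[of _ \<eta>] conjI ballI impI \<eta>)
    fix s' :: real assume s': "s' \<in> {0..1}" "dist s' s < \<eta>"
    have "\<bar>(s' * u + (1 - s') * z) - (s * u + (1 - s) * z)\<bar> < \<delta>" if "u \<in> set xs" for u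
    proof -
      have "(s' * u + (1 - s') * z) - (s * u + (1 - s) * z) = (s' - s) * (u - z)"
        by (simp add: algebra_simps)
      then have "\<bar>(s' * u + (1 - s') * z) - (s * u + (1 - s) * z)\<bar> = \<bar>s' - s\<bar> * \<bar>u - z\<bar>"
        by (simp add: abs_mult)
      also have "\<dots> \<le> \<bar>s' - s\<bar> * (2 * M + 1)"
        using M(1) M(2)[OF that] by (intro mult_left_mono) auto
      also have "\<dots> < \<eta> * (2 * M + 1)"
        using s'(2) M0 by (intro mult_strict_right_mono) (auto simp: dist_real_def)
      also have "\<dots> = \<delta>" using M0 by (simp add: \<eta>_def)
      finally show ?thesis .
    qed
    then have "\<bar>simplex_integral g (map (\<lambda>u. s' * u + (1 - s') * z) xs)
      - simplex_integral g (map (\<lambda>u. s * u + (1 - s) * z) xs)\<bar> \<le> \<epsilon> / 2"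
      using s s' M convex_combination_abs_le
      by (intro \<delta>(2)) (auto simp: list_all2_conv_all_nth)
    then show "dist (simplex_integral g (map (\<lambda>u. s' * u + (1 - s') * z) xs))
      (simplex_integral g (map (\<lambda>u. s * u + (1 - s) * z) xs)) < \<epsilon>"
      using \<epsilon> by (simp add: dist_real_def)
  qed
qed

text \<open>Single nodes are handled by uniform continuity on a compact interval. Adding an apex
  costs nothing: convex combinations with the same s stay in the same bounded interval and are no
  further apart than their ingredients, and the weight is at most 1, so the \<delta> for length n
  also serves for length n + 1.\<close>

lemma equicont_at_length:
  assumes "continuous_on UNIV g" shows "equicont_at_length g n"
proof (induction n)
  case 0
  show ?case unfolding equicont_at_length_def by (auto intro: exI[of _ 1])
next
  case (Suc n)
  note IH = Suc.IH
  show ?case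
    unfolding equicont_at_length_def
  proof (intro allI impI)
    fix M \<epsilon> :: real assume \<epsilon>: "\<epsilon> > 0"
    show "\<exists>\<delta>>0. \<forall>xs ys. length xs = Suc n \<longrightarrow> (\<forall>x\<in>set xs \<union> set ys. \<bar>x\<bar> \<le> M) \<longrightarrow>
      list_all2 (\<lambda>x y. \<bar>y - x\<bar> < \<delta>) xs ys \<longrightarrow> \<bar>simplex_integral g ys - simplex_integral g xs\<bar> \<le> \<epsilon>"
    proof (cases n)
      case 0
      have "uniformly_continuous_on {-M..M} g"
        using assms by (intro compact_uniformly_continuous continuous_on_subset[OF assms]) auto
      then obtain \<delta> where \<delta>: "\<delta> > 0" and
        g: "\<And>x y. x \<in> {-M..M} \<Longrightarrow> y \<in> {-M..M} \<Longrightarrow> dist y x < \<delta> \<Longrightarrow> dist (g y) (g x) < \<epsilon>"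
        using \<epsilon> unfolding uniformly_continuous_on_def by metis
      show ?thesis
      proof (intro exI[of _ \<delta>] conjI allI impI \<delta>)
        fix xs ys assume "length xs = Suc n" "\<forall>x\<in>set xs \<union> set ys. \<bar>x\<bar> \<le> M"
          "list_all2 (\<lambda>x y. \<bar>y - x\<bar> < \<delta>) xs ys"
        moreover from this obtain x y where "xs = [x]" "ys = [y]"
          using 0 by (auto simp: length_Suc_conv list_all2_Cons1)
        ultimately show "\<bar>simplex_integral g ys - simplex_integral g xs\<bar> \<le> \<epsilon>"
          using g[of x y] by (auto simp: dist_real_def abs_le_iff)
      qed
    next
      case (Suc m)
      obtain \<delta> where \<delta>: "\<delta> > 0" "\<And>xs ys. length xs = n \<Longrightarrow> \<forall>x\<in>set xs \<union> set ys. \<bar>x\<bar> \<le> M \<Longrightarrow>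
        list_all2 (\<lambda>x y. \<bar>y - x\<bar> < \<delta>) xs ys \<Longrightarrow> \<bar>simplex_integral g ys - simplex_integral g xs\<bar> \<le> \<epsilon>"
        using equicont_at_lengthD[OF IH \<epsilon>, of M] by blast
      show ?thesis
      proof (intro exI[of _ \<delta>] conjI allI impI \<delta>(1))
        fix xs ys assume len: "length xs = Suc n" and M: "\<forall>x\<in>set xs \<union> set ys. \<bar>x\<bar> \<le> M"
          and close: "list_all2 (\<lambda>x y. \<bar>y - x\<bar> < \<delta>) xs ys"
        obtain x xs' where xs: "xs = x # xs'" "length xs' = n" using len by (cases xs) auto
        obtain y ys' where ys: "ys = y # ys'" "\<bar>y - x\<bar> < \<delta>" "list_all2 (\<lambda>x y. \<bar>y - x\<bar> < \<delta>) xs' ys'"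
          using close xs by (auto simp: list_all2_Cons1)
        have len': "length ys' = n" using ys xs by (auto dest: list_all2_lengthD)
        let ?f = "\<lambda>s. simplex_integral g (map (\<lambda>u. s * u + (1 - s) * x) xs')"
        let ?h = "\<lambda>s. simplex_integral g (map (\<lambda>u. s * u + (1 - s) * y) ys')"
        have f: "continuous_on {0..1} ?f" using IH xs by (intro continuous_on_cone_integrand) simp
        have h: "continuous_on {0..1} ?h" using IH len' by (intro continuous_on_cone_integrand) simp
        have fh: "\<bar>?h s - ?f s\<bar> \<le> \<epsilon>" if s: "s \<in> {0..1}" for s
        proof (rule \<delta>(2))
          show "list_all2 (\<lambda>x y. \<bar>y - x\<bar> < \<delta>) (map (\<lambda>u. s * u + (1 - s) * x) xs')
            (map (\<lambda>u. s * u + (1 - s) * y) ys')"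
            unfolding list_all2_map1 list_all2_map2 using ys(3)
          proof (rule list_all2_mono)
            fix u v assume uv: "\<bar>v - u\<bar> < \<delta>"
            have "(s * v + (1 - s) * y) - (s * u + (1 - s) * x) = s * (v - u) + (1 - s) * (y - x)"
              by (simp add: algebra_simps)
            moreover have "\<bar>s * (v - u) + (1 - s) * (y - x)\<bar> \<le> max \<bar>v - u\<bar> \<bar>y - x\<bar>"
              by (intro convex_combination_abs_le s) auto
            ultimately show "\<bar>(s * v + (1 - s) * y) - (s * u + (1 - s) * x)\<bar> < \<delta>"
              using uv ys(2) by simp
          qed
        qed (use xs ys M s in \<open>auto intro!: convex_combination_abs_le\<close>)
        have ne: "xs' \<noteq> []" "ys' \<noteq> []" using xs len' Suc by auto
        have "simplex_integral g ys - simplex_integral g xs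
          = integral {0..1} (\<lambda>s. s ^ (n - 1) * ?h s) - integral {0..1} (\<lambda>s. s ^ (n - 1) * ?f s)"
          unfolding xs(1) ys(1) simplex_integral_Cons[OF ne(1)] simplex_integral_Cons[OF ne(2)] xs(2) len' ..
        also have "\<dots> = integral {0..1} (\<lambda>s. s ^ (n - 1) * ?h s - s ^ (n - 1) * ?f s)"
          by (intro integral_diff[symmetric] integrable_continuous_real continuous_intros f h)
        finally have eq: "simplex_integral g ys - simplex_integral g xs
          = integral {0..1} (\<lambda>s. s ^ (n - 1) * ?h s - s ^ (n - 1) * ?f s)" .
        have "norm (integral {0..1} (\<lambda>s. s ^ (n - 1) * ?h s - s ^ (n - 1) * ?f s)) \<le> \<epsilon> * (1 - 0)"
        proof (rule integral_bound)
          show "continuous_on {0..1} (\<lambda>s. s ^ (n - 1) * ?h s - s ^ (n - 1) * ?f s)"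
            by (intro continuous_intros f h)
          fix s :: real assume s: "s \<in> {0..1}"
          have "\<bar>s ^ (n - 1) * ?h s - s ^ (n - 1) * ?f s\<bar> = s ^ (n - 1) * \<bar>?h s - ?f s\<bar>"
            using s by (simp add: right_diff_distrib[symmetric] abs_mult)
          also have "\<dots> \<le> 1 * \<epsilon>"
            using s fh[OF s] by (intro mult_mono power_le_one) auto
          finally show "norm (s ^ (n - 1) * ?h s - s ^ (n - 1) * ?f s) \<le> \<epsilon>" by simp
        qed simp
        then show "\<bar>simplex_integral g ys - simplex_integral g xs\<bar> \<le> \<epsilon>" unfolding eq by simp
      qed
    qed
  qed
qed

lemma simplex_integral_bounded:
  assumes g: "continuous_on UNIV g" and C: "\<And>x. \<bar>x\<bar> \<le> M \<Longrightarrow> \<bar>g x\<bar> \<le> C" and "C \<ge> 0"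
  shows "\<forall>x\<in>set xs. \<bar>x\<bar> \<le> M \<Longrightarrow> \<bar>simplex_integral g xs\<bar> \<le> C"
proof (induction "length xs" arbitrary: xs)
  case 0 then show ?case using \<open>C \<ge> 0\<close> by simp
next
  case (Suc n)
  then obtain z xs' where xs: "xs = z # xs'" "length xs' = n" by (cases xs) auto
  show ?case
  proof (cases "xs' = []")
    case True then show ?thesis using xs Suc.prems C by simp
  next
    case False
    let ?f = "\<lambda>s. simplex_integral g (map (\<lambda>u. s * u + (1 - s) * z) xs')"
    have f: "continuous_on {0..1} ?f"
      by (intro continuous_on_cone_integrand equicont_at_length g)
    have "norm (integral {0..1} (\<lambda>s. s ^ (length xs' - 1) * ?f s)) \<le> C * (1 - 0)"
    proof (rule integral_bound)
      show "continuous_on {0..1} (\<lambda>s. s ^ (length xs' - 1) * ?f s)" by (intro continuous_intros f)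
      fix s :: real assume s: "s \<in> {0..1}"
      have "\<bar>?f s\<bar> \<le> C"
        using xs Suc.prems s by (intro Suc.hyps(1)) (auto intro!: convex_combination_abs_le)
      then have "s ^ (length xs' - 1) * \<bar>?f s\<bar> \<le> 1 * C"
        using s by (intro mult_mono power_le_one) auto
      then show "norm (s ^ (length xs' - 1) * ?f s) \<le> C" using s by (simp add: abs_mult)
    qed simp
    then show ?thesis using xs False by (simp add: simplex_integral_Cons)
  qed
qed

text \<open>For two nodes this is the fundamental theorem of calculus along the segment. In the cone
  over further nodes the last two differ by s (x - y), and the additional s is exactly the amount by
  which the weight for \<open>g'\<close> exceeds that for \<open>g\<close>. The apex is the head of
  the list, hence the formulation for the last two entries.\<close>

lemma simplex_integral_recurrence:
  assumes g: "continuous_on UNIV g" and g': "continuous_on UNIV g'"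
    and deriv: "\<And>x. (g has_real_derivative g' x) (at x)"
  shows "(x - y) * simplex_integral g' (zs @ [x, y]) = simplex_integral g (zs @ [x]) - simplex_integral g (zs @ [y])"
proof (induction "length zs" arbitrary: zs x y)
  case 0
  have "((\<lambda>s. (y - x) * g' (s * y + (1 - s) * x)) has_integral
      g (1 * y + (1 - 1) * x) - g (0 * y + (1 - 0) * x)) {0..1}"
  proof (rule fundamental_theorem_of_calculus)
    fix s :: real assume "s \<in> {0..1}"
    have "((\<lambda>s. g (s * y + (1 - s) * x)) has_real_derivative g' (s * y + (1 - s) * x) * (y - x))
      (at s within {0..1})"
      by (rule DERIV_chain2[OF deriv]) (auto intro!: derivative_eq_intros)
    then show "((\<lambda>s. g (s * y + (1 - s) * x)) has_vector_derivative (y - x) * g' (s * y + (1 - s) * x))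
      (at s within {0..1})"
      by (simp add: has_real_derivative_iff_has_vector_derivative mult.commute)
  qed simp
  from integral_unique[OF this]
  have "(y - x) * integral {0..1} (\<lambda>s. g' (s * y + (1 - s) * x)) = g y - g x" by simp
  then show ?case using 0 by (simp add: simplex_integral_Cons algebra_simps)
next
  case (Suc n)
  then obtain z zs' where zs: "zs = z # zs'" "length zs' = n" by (cases zs) auto
  let ?m = "\<lambda>s. map (\<lambda>u. s * u + (1 - s) * z)"
  have cont: "continuous_on {0..1} (\<lambda>s. simplex_integral g (?m s us))"
    "continuous_on {0..1} (\<lambda>s. simplex_integral g' (?m s us))" for us
    by (intro continuous_on_cone_integrand equicont_at_length g g')+
  have "(x - y) * simplex_integral g' (zs @ [x, y])
    = integral {0..1} (\<lambda>s. (x - y) * (s ^ Suc n * simplex_integral g' (?m s (zs' @ [x, y]))))"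
    using zs by (simp add: simplex_integral_Cons)
  also have "\<dots> = integral {0..1} (\<lambda>s. s ^ n * simplex_integral g (?m s (zs' @ [x]))
      - s ^ n * simplex_integral g (?m s (zs' @ [y])))"
  proof (rule integral_cong)
    fix s :: real
    let ?x = "s * x + (1 - s) * z" and ?y = "s * y + (1 - s) * z"
    have "(?x - ?y) * simplex_integral g' (?m s zs' @ [?x, ?y])
      = simplex_integral g (?m s zs' @ [?x]) - simplex_integral g (?m s zs' @ [?y])"
      using zs by (intro Suc.hyps(1)) simp
    moreover have "?x - ?y = s * (x - y)" by (simp add: algebra_simps)
    ultimately have eq: "s * (x - y) * simplex_integral g' (?m s zs' @ [?x, ?y])
      = simplex_integral g (?m s zs' @ [?x]) - simplex_integral g (?m s zs' @ [?y])" by simp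
    have "(x - y) * (s ^ Suc n * simplex_integral g' (?m s (zs' @ [x, y])))
      = s ^ n * (s * (x - y) * simplex_integral g' (?m s zs' @ [?x, ?y]))" by simp
    then show "(x - y) * (s ^ Suc n * simplex_integral g' (?m s (zs' @ [x, y])))
      = s ^ n * simplex_integral g (?m s (zs' @ [x])) - s ^ n * simplex_integral g (?m s (zs' @ [y]))"
      unfolding eq by (simp add: right_diff_distrib)
  qed
  also have "\<dots> = integral {0..1} (\<lambda>s. s ^ n * simplex_integral g (?m s (zs' @ [x])))
      - integral {0..1} (\<lambda>s. s ^ n * simplex_integral g (?m s (zs' @ [y])))"
    by (intro integral_diff integrable_continuous_real continuous_intros cont)
  also have "\<dots> = simplex_integral g (zs @ [x]) - simplex_integral g (zs @ [y])"
    using zs by (simp add: simplex_integral_Cons)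
  finally show ?case .
qed

section \<open>A compactly supported smooth function on the reals built from exp(-1/u)\<close>

definition flat_exp :: "real poly \<Rightarrow> real \<Rightarrow> real" where
  "flat_exp p u = (if u > 0 then poly p (1 / u) * exp (- (1 / u)) else 0)"

text \<open>The power of y is there for the induction: splitting off the constant coefficient of the
  polynomial raises the exponent by one.\<close>

lemma poly_times_exp_minus_tendsto_0:
  "((\<lambda>y. y ^ k * poly p y * exp (- y)) \<longlongrightarrow> (0::real)) at_top"
proof (induction p arbitrary: k)
  case 0
  then show ?case by simp
next
  case (pCons a p)
  have "((\<lambda>y. a * (y ^ k / exp y) + y ^ Suc k * poly p y * exp (- y)) \<longlongrightarrow> a * 0 + 0) at_top"
    by (intro tendsto_intros tendsto_power_div_exp_0 pCons.IH)
  then show ?case by (simp add: algebra_simps exp_minus divide_inverse)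
qed

lemma flat_exp_div_tendsto_0: "((\<lambda>u. flat_exp p u / u) \<longlongrightarrow> 0) (at 0)"
proof -
  have "((\<lambda>u. (1 / u) ^ 1 * poly p (1 / u) * exp (- (1 / u))) \<longlongrightarrow> (0::real)) (at_right 0)"
    using filterlim_compose[OF poly_times_exp_minus_tendsto_0[of 1 p] filterlim_inverse_at_top_right]
    by (simp add: inverse_eq_divide)
  then have r: "((\<lambda>u. flat_exp p u / u) \<longlongrightarrow> 0) (at_right 0)"
    by (rule Lim_transform_eventually)
       (auto simp: flat_exp_def eventually_at_right_field intro!: exI[of _ 1])
  have "((\<lambda>u. 0) \<longlongrightarrow> (0::real)) (at_left 0)" by simp
  then have "((\<lambda>u. flat_exp p u / u) \<longlongrightarrow> 0) (at_left 0)"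
    by (rule Lim_transform_eventually)
       (auto simp: flat_exp_def eventually_at_left_field intro!: exI[of _ "-1"])
  with r show ?thesis by (simp add: filterlim_split_at)
qed

text \<open>With y = 1/u, the derivative of p(y) exp(-y) in u is y^2 (p(y) - p'(y)) exp(-y), and
  \<open>[:0, 0, 1:]\<close> is the polynomial y^2. So the family of all \<open>flat_exp p\<close>
  is closed under differentiation; at 0 the difference quotient is
  \<open>flat_exp p u / u\<close>.\<close>

lemma flat_exp_has_derivative:
  "(flat_exp p has_real_derivative flat_exp ([:0, 0, 1:] * (p - pderiv p)) u) (at u)"
proof -
  consider "u > 0" | "u < 0" | "u = 0" by linarith
  then show ?thesis
  proof cases
    case 1
    have "((\<lambda>u. poly p (1 / u) * exp (- (1 / u))) has_real_derivative
      poly (pderiv p) (1 / u) * (- (1 / u\<^sup>2)) * exp (- (1 / u)) + exp (- (1 / u)) * (1 / u\<^sup>2) * poly p (1 / u)) (at u)"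
    proof (rule DERIV_mult)
      have "((\<lambda>u::real. 1 / u) has_real_derivative - (1 / u\<^sup>2)) (at u)"
        using 1 by (auto intro!: derivative_eq_intros simp: power2_eq_square)
      from DERIV_chain2[OF poly_DERIV this] DERIV_chain2[OF DERIV_exp DERIV_minus[OF this]]
      show "((\<lambda>u. poly p (1 / u)) has_real_derivative poly (pderiv p) (1 / u) * (- (1 / u\<^sup>2))) (at u)"
        "((\<lambda>u. exp (- (1 / u))) has_real_derivative exp (- (1 / u)) * (1 / u\<^sup>2)) (at u)"
        by simp_all
    qed
    moreover have "poly (pderiv p) (1 / u) * (- (1 / u\<^sup>2)) * exp (- (1 / u))
        + exp (- (1 / u)) * (1 / u\<^sup>2) * poly p (1 / u) = flat_exp ([:0, 0, 1:] * (p - pderiv p)) u"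
      using 1 by (simp add: flat_exp_def field_simps power2_eq_square)
    ultimately have "((\<lambda>u. poly p (1 / u) * exp (- (1 / u))) has_real_derivative
      flat_exp ([:0, 0, 1:] * (p - pderiv p)) u) (at u)" by simp
    then show ?thesis
      by (rule has_field_derivative_transform_within_open[of _ _ _ "{0<..}"])
         (use 1 in \<open>auto simp: flat_exp_def\<close>)
  next
    case 2
    have "((\<lambda>u. 0) has_real_derivative flat_exp ([:0, 0, 1:] * (p - pderiv p)) u) (at u)"
      using 2 by (simp add: flat_exp_def)
    then show ?thesis
      by (rule has_field_derivative_transform_within_open[of _ _ _ "{..<0}"])
         (use 2 in \<open>auto simp: flat_exp_def\<close>)
  next
    case 3
    then show ?thesis
      using flat_exp_div_tendsto_0[of p] by (simp add: has_field_derivative_iff flat_exp_def)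
  qed
qed

inductive_set bump_derivs :: "real \<Rightarrow> real \<Rightarrow> (real \<Rightarrow> real) set" for t r where
  base: "(\<lambda>x. flat_exp p (r + (x - t)) * flat_exp q (r - (x - t))) \<in> bump_derivs t r"
| add: "f \<in> bump_derivs t r \<Longrightarrow> g \<in> bump_derivs t r \<Longrightarrow> (\<lambda>x. f x + g x) \<in> bump_derivs t r"

lemma bump_derivs_closed:
  "f \<in> bump_derivs t r \<Longrightarrow> \<exists>f'\<in>bump_derivs t r. \<forall>x. (f has_real_derivative f' x) (at x)"
proof (induction rule: bump_derivs.induct)
  case (base p q)
  let ?d = "\<lambda>p. [:0, 0, 1:] * (p - pderiv p) :: real poly"
  let ?f = "\<lambda>x. flat_exp (?d p) (r + (x - t)) * flat_exp q (r - (x - t))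
    + flat_exp p (r + (x - t)) * flat_exp (- ?d q) (r - (x - t))"
  have neg: "flat_exp (- ?d q) u = - flat_exp (?d q) u" for u
    by (simp add: flat_exp_def del: mult_pCons_left)
  have "((\<lambda>x. flat_exp p (r + (x - t)) * flat_exp q (r - (x - t))) has_real_derivative ?f x) (at x)" for x
  proof -
    have "((\<lambda>x. flat_exp p (r + (x - t))) has_real_derivative flat_exp (?d p) (r + (x - t)) * 1) (at x)"
      by (rule DERIV_chain2[OF flat_exp_has_derivative]) (auto intro!: derivative_eq_intros)
    moreover have "((\<lambda>x. flat_exp q (r - (x - t))) has_real_derivative
        flat_exp (?d q) (r - (x - t)) * (- 1)) (at x)"
      by (rule DERIV_chain2[OF flat_exp_has_derivative]) (auto intro!: derivative_eq_intros)
    ultimately show ?thesis unfolding neg by (auto dest: DERIV_mult simp: algebra_simps)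
  qed
  then show ?case by (intro bexI[of _ ?f] allI bump_derivs.intros)
next
  case (add f g)
  then obtain f' g' where "f' \<in> bump_derivs t r" "g' \<in> bump_derivs t r"
    "\<forall>x. (f has_real_derivative f' x) (at x)" "\<forall>x. (g has_real_derivative g' x) (at x)" by blast
  then show ?case
    by (intro bexI[of _ "\<lambda>x. f' x + g' x"]) (auto intro: bump_derivs.add DERIV_add)
qed

lemma real_smooth_bump:
  fixes t r :: real
  assumes "r > 0"
  shows "\<exists>g. (\<forall>i x. (g i has_real_derivative g (Suc i) x) (at x)) \<and> g 0 t = 1 \<and>
    (\<forall>x. \<bar>x - t\<bar> \<ge> r \<longrightarrow> g 0 x = 0)"
proof -
  \<comment> \<open>At x = t both exponential factors equal exp(-1/r); the constant exp(2/r)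
    normalises the value there to 1.\<close>
  let ?b = "\<lambda>x. flat_exp [:exp (2 / r):] (r + (x - t)) * flat_exp [:1:] (r - (x - t))"
  have "\<exists>g. \<forall>i. (g i \<in> bump_derivs t r \<and> (i = 0 \<longrightarrow> g i = ?b)) \<and>
      (\<forall>x. (g i has_real_derivative g (Suc i) x) (at x))"
  proof (rule dependent_nat_choice)
    show "\<exists>f. f \<in> bump_derivs t r \<and> (0 = 0 \<longrightarrow> f = ?b)" by (blast intro: bump_derivs.base)
  qed (use bump_derivs_closed in fastforce)
  then obtain g where g: "\<And>i x. (g i has_real_derivative g (Suc i) x) (at x)" and g0: "g 0 = ?b" by blast
  have "?b t = 1" using assms by (simp add: flat_exp_def exp_add[symmetric] mult_exp_exp)
  moreover have "?b x = 0" if "\<bar>x - t\<bar> \<ge> r" for x using that assms by (auto simp: flat_exp_def abs_if split: if_splits)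
  ultimately show ?thesis using g g0 by (intro exI[of _ g]) auto
qed

lemma (in valued_field) real_dd_bump:
  assumes real: "is_real_abs av" and r: "r > 0"
  shows "\<exists>D. dd_bump t r D"
proof -
  obtain \<phi> :: "'k \<Rightarrow> real" where bij: "bij \<phi>" and add: "\<And>x y. \<phi> (x + y) = \<phi> x + \<phi> y"
    and mult: "\<And>x y. \<phi> (x * y) = \<phi> x * \<phi> y" and av: "\<And>x. av x = \<bar>\<phi> x\<bar>"
    using real unfolding is_real_abs_def by blast
  have inv: "\<phi> (inv \<phi> x) = x" for x using bij by (simp add: bij_is_surj surj_f_inv_f)
  have inj: "\<phi> x = \<phi> y \<longleftrightarrow> x = y" for x y using bij by (simp add: bij_is_inj inj_eq)
  have zero: "\<phi> 0 = 0" using add[of 0 0] by simp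
  have diff: "\<phi> (x - y) = \<phi> x - \<phi> y" for x y using add[of "x - y" y] by simp
  have one: "\<phi> 1 = 1" using mult[of 1 1] inj[of 1 0] zero by simp
  obtain g where deriv: "\<And>i x. (g i has_real_derivative g (Suc i) x) (at x)"
    and g1: "g 0 (\<phi> t) = 1" and g0: "\<And>x. \<bar>x - \<phi> t\<bar> \<ge> r \<Longrightarrow> g 0 x = 0"
    using real_smooth_bump[OF r, of "\<phi> t"] by blast
  have cont: "continuous_on UNIV (g i)" for i
    using deriv by (meson DERIV_isCont continuous_at_imp_continuous_on)
  \<comment> \<open>The recurrence concerns the last two nodes and \<open>dd_system\<close> the
    first two, hence \<open>rev\<close>. A list of m + 1 nodes uses the m-th derivative; on the
    empty list truncated subtraction picks \<open>g 0\<close>, but the integral is 0 by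
    definition.\<close>
  define D where "D = (\<lambda>xs. inv \<phi> (simplex_integral (g (length xs - 1)) (rev (map \<phi> xs))))"
  have \<phi>D: "\<phi> (D xs) = simplex_integral (g (length xs - 1)) (rev (map \<phi> xs))" for xs
    by (simp add: D_def inv)
  have "dd_system (*) D"
    unfolding dd_system_def
  proof (intro allI)
    fix x y zs
    have "(\<phi> y - \<phi> x) * \<phi> (D (x # y # zs)) = \<phi> (D (y # zs)) - \<phi> (D (x # zs))"
      unfolding \<phi>D using simplex_integral_recurrence[OF cont cont deriv] by simp
    then have "\<phi> (D (x # zs) - D (y # zs)) = \<phi> ((x - y) * D (x # y # zs))"
      by (simp add: diff mult algebra_simps)
    then show "D (x # zs) - D (y # zs) = (x - y) * D (x # y # zs)" by (simp add: inj)
  qed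
  moreover have "dd_continuous av (abs_topology av) D"
    unfolding dd_continuous_scalar_iff
  proof (intro allI impI)
    fix xs :: "'k list" and \<epsilon> :: real assume \<epsilon>: "\<epsilon> > 0"
    define M where "M = sum_list (map av xs) + 1"
    have M: "av x + 1 \<le> M" if "x \<in> set xs" for x
    proof -
      have "av x \<le> sum_list (map av xs)" by (rule member_le_sum_list) (use that in auto)
      then show ?thesis by (simp add: M_def)
    qed
    obtain \<delta> where \<delta>: "\<delta> > 0" "\<And>us ys. length us = length xs \<Longrightarrow> \<forall>x\<in>set us \<union> set ys. \<bar>x\<bar> \<le> M \<Longrightarrow>
      list_all2 (\<lambda>x y. \<bar>y - x\<bar> < \<delta>) us ys \<Longrightarrow>
      \<bar>simplex_integral (g (length xs - 1)) ys - simplex_integral (g (length xs - 1)) us\<bar> \<le> \<epsilon> / 2"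
      using equicont_at_lengthD[OF equicont_at_length[OF cont, of "length xs - 1" "length xs"] half_gt_zero[OF \<epsilon>], of M]
      by blast
    show "\<exists>\<delta>>0. \<forall>ys. list_all2 (\<lambda>x y. av (y - x) < \<delta>) xs ys \<longrightarrow> av (D ys - D xs) < \<epsilon>"
    proof (intro exI[of _ "min 1 \<delta>"] conjI allI impI)
      fix ys assume close: "list_all2 (\<lambda>x y. av (y - x) < min 1 \<delta>) xs ys"
      have len: "length ys = length xs" using close by (auto dest: list_all2_lengthD)
      have "av y \<le> M" if y: "y \<in> set ys" for y
      proof -
        obtain i where "i < length ys" "y = ys ! i" using y by (auto simp: in_set_conv_nth)
        then have "av (y - xs ! i) < 1" "xs ! i \<in> set xs"
          using close len by (auto simp: list_all2_conv_all_nth)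
        then show ?thesis using M[of "xs ! i"] av_triangle[of "y - xs ! i" "xs ! i"] by simp
      qed
      moreover have "av x \<le> M" if "x \<in> set xs" for x using M[OF that] by simp
      moreover have "list_all2 (\<lambda>x y. \<bar>y - x\<bar> < \<delta>) (map \<phi> xs) (map \<phi> ys)"
        unfolding list_all2_map1 list_all2_map2 using close
        by (rule list_all2_mono) (simp add: av diff)
      ultimately have "\<bar>simplex_integral (g (length xs - 1)) (rev (map \<phi> ys))
        - simplex_integral (g (length xs - 1)) (rev (map \<phi> xs))\<bar> \<le> \<epsilon> / 2"
        by (intro \<delta>(2)) (auto simp: av)
      then show "av (D ys - D xs) < \<epsilon>" using \<epsilon> by (simp add: av diff \<phi>D len)
    qed (use \<delta> in auto)
  qed
  moreover have "\<exists>C. \<forall>xs. length xs = n \<and> (\<forall>x\<in>set xs. av x \<le> M) \<longrightarrow> av (D xs) \<le> C" for n M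
  proof -
    have "compact (g (n - 1) ` {-M..M})"
      by (intro compact_continuous_image continuous_on_subset[OF cont]) auto
    then obtain C where C: "\<forall>y\<in>g (n - 1) ` {-M..M}. norm y \<le> C"
      using compact_imp_bounded bounded_iff by blast
    \<comment> \<open>For negative M the interval is empty and C may be negative, hence the maximum
      with 0.\<close>
    have "av (D xs) \<le> max C 0" if "length xs = n" "\<forall>x\<in>set xs. av x \<le> M" for xs
    proof -
      have "\<bar>simplex_integral (g (n - 1)) (rev (map \<phi> xs))\<bar> \<le> max C 0"
      proof (rule simplex_integral_bounded[OF cont])
        show "\<bar>g (n - 1) x\<bar> \<le> max C 0" if "\<bar>x\<bar> \<le> M" for x
        proof -
          have "x \<in> {-M..M}" using that by (auto simp: abs_le_iff)
          then show ?thesis using C by force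
        qed
      qed (use that in \<open>auto simp: av\<close>)
      then show ?thesis using that by (simp add: av \<phi>D)
    qed
    then show ?thesis by blast
  qed
  moreover have "D [] = 0" using \<phi>D[of "[]"] zero inj[of "D []" 0] by simp
  moreover have "D [t] = 1" using \<phi>D[of "[t]"] g1 one inj[of "D [t]" 1] by simp
  moreover have "D [x] = 0" if "av (x - t) \<ge> r" for x
    using \<phi>D[of "[x]"] g0[of "\<phi> x"] that zero inj[of "D [x]" 0] by (simp add: av diff)
  ultimately have "dd_bump t r D" unfolding dd_bump_def by blast
  then show ?thesis by blast
qed

section \<open>Curves through rapidly converging sequences\<close>

context valued_field
begin

text \<open>The disjoint union of all finite powers of the field as a single space: it turns
  \<open>dd_continuous\<close> into continuity of a map, so that sums and scalar multiples are
  covered by the general continuity lemmas.\<close>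

definition list_topology :: "'k list topology" where
  "list_topology = topology (\<lambda>U. \<forall>xs\<in>U. \<exists>\<delta>>0. \<forall>ys.
     list_all2 (\<lambda>x y. av (y - x) < \<delta>) xs ys \<longrightarrow> ys \<in> U)"

lemma openin_list_topology:
  "openin list_topology U \<longleftrightarrow> (\<forall>xs\<in>U. \<exists>\<delta>>0. \<forall>ys.
     list_all2 (\<lambda>x y. av (y - x) < \<delta>) xs ys \<longrightarrow> ys \<in> U)"
proof -
  have mono: "list_all2 (\<lambda>x y. av (y - x) < \<delta>') xs ys"
    if "list_all2 (\<lambda>x y. av (y - x) < \<delta>) xs ys" "\<delta> \<le> \<delta>'" for \<delta> \<delta>' xs ys
    using that by (elim list_all2_mono) auto
  have "istopology (\<lambda>U. \<forall>xs\<in>U. \<exists>\<delta>>0. \<forall>ys. list_all2 (\<lambda>x y. av (y - x) < \<delta>) xs ys \<longrightarrow> ys \<in> U)"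
    unfolding istopology_def
  proof (intro conjI allI impI ballI)
    fix S T xs
    assume S: "\<forall>xs\<in>S. \<exists>\<delta>>0. \<forall>ys. list_all2 (\<lambda>x y. av (y - x) < \<delta>) xs ys \<longrightarrow> ys \<in> S"
      and T: "\<forall>xs\<in>T. \<exists>\<delta>>0. \<forall>ys. list_all2 (\<lambda>x y. av (y - x) < \<delta>) xs ys \<longrightarrow> ys \<in> T"
      and xs: "xs \<in> S \<inter> T"
    obtain \<delta> where "\<delta> > 0" "\<forall>ys. list_all2 (\<lambda>x y. av (y - x) < \<delta>) xs ys \<longrightarrow> ys \<in> S" using S xs by auto
    moreover obtain \<delta>' where "\<delta>' > 0" "\<forall>ys. list_all2 (\<lambda>x y. av (y - x) < \<delta>') xs ys \<longrightarrow> ys \<in> T"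
      using T xs by auto
    ultimately show "\<exists>\<delta>>0. \<forall>ys. list_all2 (\<lambda>x y. av (y - x) < \<delta>) xs ys \<longrightarrow> ys \<in> S \<inter> T"
      using mono[of "min \<delta> \<delta>'"] by (intro exI[of _ "min \<delta> \<delta>'"]) auto
  next
    fix \<K> xs
    assume \<K>: "\<forall>K\<in>\<K>. \<forall>xs\<in>K. \<exists>\<delta>>0. \<forall>ys. list_all2 (\<lambda>x y. av (y - x) < \<delta>) xs ys \<longrightarrow> ys \<in> K"
      and "xs \<in> \<Union>\<K>"
    then obtain K where "K \<in> \<K>" "xs \<in> K" by blast
    moreover from this obtain \<delta> where "\<delta> > 0"
      "\<forall>ys. list_all2 (\<lambda>x y. av (y - x) < \<delta>) xs ys \<longrightarrow> ys \<in> K" using \<K> by meson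
    ultimately show "\<exists>\<delta>>0. \<forall>ys. list_all2 (\<lambda>x y. av (y - x) < \<delta>) xs ys \<longrightarrow> ys \<in> \<Union>\<K>" by auto
  qed
  then show ?thesis unfolding list_topology_def by (subst topology_inverse') (assumption, rule refl)
qed

lemma topspace_list_topology [simp]: "topspace list_topology = UNIV"
proof -
  have "openin list_topology UNIV" unfolding openin_list_topology by (auto intro: exI[of _ 1])
  then show ?thesis using openin_subset by blast
qed

lemma dd_continuous_iff_continuous_map:
  assumes "topspace T = UNIV"
  shows "dd_continuous av T D \<longleftrightarrow> continuous_map list_topology T D"
  unfolding dd_continuous_def continuous_map_def openin_list_topology using assms by auto

end

section \<open>Strings of balanced neighbourhoods of zero\<close>

context valued_tvs
begin

definition zero_nbhd :: "'e set \<Rightarrow> bool" where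
  "zero_nbhd V \<longleftrightarrow> (\<exists>W. openin TE W \<and> 0 \<in> W \<and> W \<subseteq> V)"

definition balanced :: "'e set \<Rightarrow> bool" where
  "balanced V \<longleftrightarrow> (\<forall>a v. av a \<le> 1 \<and> v \<in> V \<longrightarrow> sm a v \<in> V)"

text \<open>A string takes the place of a translation-invariant metric: the halving condition
  controls finite sums, balancedness controls scalars of size at most 1, and the last condition
  makes the members a base at 0.\<close>

definition nbhd_string :: "(nat \<Rightarrow> 'e set) \<Rightarrow> bool" where
  "nbhd_string V \<longleftrightarrow> (\<forall>n. zero_nbhd (V n) \<and> balanced (V n) \<and>
       (\<forall>u\<in>V (Suc n). \<forall>v\<in>V (Suc n). u + v \<in> V n)) \<and>
     (\<forall>W. openin TE W \<and> 0 \<in> W \<longrightarrow> (\<exists>n. V n \<subseteq> W))"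

text \<open>V is the largest balanced subset of a neighbourhood N whose sum with itself lies in W.
  It contains a neighbourhood of 0: continuity of scalar multiplication at (0, 0) provides A and M,
  and b v = (b \<rho>) (v / \<rho>) with \<rho> so small that b \<rho> lies in A for all b of size
  at most 1.\<close>

lemma ex_balanced_half:
  assumes "zero_nbhd W"
  shows "\<exists>V. zero_nbhd V \<and> balanced V \<and> (\<forall>u\<in>V. \<forall>v\<in>V. u + v \<in> W)"
proof -
  obtain W' where W': "openin TE W'" "0 \<in> W'" "W' \<subseteq> W" using assms by (auto simp: zero_nbhd_def)
  have "continuous_map (prod_topology TE TE) TE (\<lambda>(x, y). x + y)" using tvs by (simp add: tvs_def)
  from openin_continuous_map_preimage[OF this W'(1)]
  have "openin (prod_topology TE TE) {z. fst z + snd z \<in> W'}" by (simp add: case_prod_unfold)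
  then obtain N1 N2 where N: "openin TE N1" "openin TE N2" "0 \<in> N1" "0 \<in> N2"
      "N1 \<times> N2 \<subseteq> {z. fst z + snd z \<in> W'}"
    using W'(2) unfolding openin_prod_topology_alt by (elim allE[of _ 0]) auto
  define N where "N = N1 \<inter> N2"
  have N': "openin TE N" "0 \<in> N" using N by (auto simp: N_def)
  have "continuous_map (prod_topology (abs_topology av) TE) TE (\<lambda>(a, x). sm a x)"
    using tvs by (simp add: tvs_def)
  from openin_continuous_map_preimage[OF this N'(1)]
  have "openin (prod_topology (abs_topology av) TE) {z. sm (fst z) (snd z) \<in> N}"
    by (simp add: case_prod_unfold)
  then obtain A M where A: "openin (abs_topology av) A" "openin TE M" "0 \<in> A" "0 \<in> M"
      "A \<times> M \<subseteq> {z. sm (fst z) (snd z) \<in> N}"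
    using N'(2) unfolding openin_prod_topology_alt by (elim allE[of _ 0]) auto
  obtain r where r: "r > 0" "\<And>a. av a < r \<Longrightarrow> a \<in> A"
    using A(1,3) unfolding openin_abs_topology by fastforce
  obtain \<rho> where \<rho>: "\<rho> \<noteq> 0" "av \<rho> < r" using ex_small[OF r(1)] by blast
  define V where "V = {v. \<forall>b. av b \<le> 1 \<longrightarrow> sm b v \<in> N}"
  have "sm b v \<in> N" if "sm (1 / \<rho>) v \<in> M" "av b \<le> 1" for b v
  proof -
    have "av (b * \<rho>) \<le> 1 * av \<rho>" unfolding av_mult using that(2) by (intro mult_right_mono) auto
    then have "b * \<rho> \<in> A" using \<rho> r(2) by auto
    then have "sm (b * \<rho>) (sm (1 / \<rho>) v) \<in> N" using A(5) that(1) by auto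
    then show ?thesis using \<rho> by (simp add: sm_mult[symmetric])
  qed
  then have "{v. sm (1 / \<rho>) v \<in> M} \<subseteq> V" by (auto simp: V_def)
  moreover have "openin TE {v. sm (1 / \<rho>) v \<in> M}" by (rule openin_dilate[OF A(2)])
  ultimately have "zero_nbhd V" unfolding zero_nbhd_def using A(4) by force
  moreover have "balanced V"
    unfolding balanced_def
  proof (intro allI impI)
    fix a v assume a: "av a \<le> 1 \<and> v \<in> V"
    have "sm b (sm a v) \<in> N" if "av b \<le> 1" for b
    proof -
      have "av (b * a) \<le> 1" unfolding av_mult using that a by (intro mult_le_one) auto
      then show ?thesis using a by (simp add: V_def sm_mult[symmetric])
    qed
    then show "sm a v \<in> V" by (simp add: V_def)
  qed
  moreover have "u + v \<in> W" if "u \<in> V" "v \<in> V" for u v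
  proof -
    have "sm 1 u \<in> N" "sm 1 v \<in> N" using that by (auto simp: V_def simp del: sm_one)
    then have "(u, v) \<in> N1 \<times> N2" by (auto simp: N_def)
    with N(5) have "u + v \<in> W'" by fastforce
    then show ?thesis using W'(3) by blast
  qed
  ultimately show ?thesis by blast
qed

lemma ex_countable_zero_base:
  assumes "metrizable_space TE"
  shows "\<exists>B :: nat \<Rightarrow> 'e set. (\<forall>n. openin TE (B n) \<and> 0 \<in> B n) \<and>
    (\<forall>W. openin TE W \<and> 0 \<in> W \<longrightarrow> (\<exists>n. B n \<subseteq> W))"
proof -
  obtain M d where M: "Metric_space M d" and TE: "TE = Metric_space.mtopology M d"
    using assms unfolding metrizable_space_def by blast
  interpret Metric_space M d by (rule M)
  have UNIV: "M = UNIV" using TE topspace_TE topspace_mtopology by simp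
  show ?thesis
  proof (intro exI[of _ "\<lambda>n. mball 0 (inverse (real (Suc n)))"] conjI allI impI)
    fix W assume "openin TE W \<and> 0 \<in> W"
    then obtain r where r: "r > 0" "mball 0 r \<subseteq> W" unfolding TE openin_mtopology by auto
    obtain n where "inverse (real (Suc n)) < r" using reals_Archimedean[OF r(1)] by blast
    then have "mball 0 (inverse (real (Suc n))) \<subseteq> mball 0 r" by (intro mball_subset_concentric) simp
    then show "\<exists>n. mball 0 (inverse (real (Suc n))) \<subseteq> W" using r by blast
  next
    fix n
    show "openin TE (mball 0 (inverse (real (Suc n))))" unfolding TE by (rule openin_mball)
    show "0 \<in> mball 0 (inverse (real (Suc n)))" 
      by (rule iffD2[OF centre_in_mball_iff]) (use UNIV in simp)
  qed
qed

text \<open>Halving is done inside the intersection of \<open>V n\<close> with the n-th set of a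
  countable base at 0, so the string becomes a base as well. This is where metrizability
  enters.\<close>

lemma ex_nbhd_string:
  assumes "metrizable_space TE" and W: "openin TE W" "0 \<in> W"
  shows "\<exists>V. nbhd_string V \<and> V 0 \<subseteq> W"
proof -
  obtain B :: "nat \<Rightarrow> 'e set" where B: "\<And>n. openin TE (B n)" "\<And>n. 0 \<in> B n"
    and base: "\<And>W. openin TE W \<Longrightarrow> 0 \<in> W \<Longrightarrow> \<exists>n. B n \<subseteq> W"
    using ex_countable_zero_base[OF assms(1)] by blast
  have subset: "V \<subseteq> S" if "zero_nbhd V" "\<forall>u\<in>V. \<forall>v\<in>V. u + v \<in> S" for V S
  proof
    fix v assume "v \<in> V"
    moreover have "0 \<in> V" using that(1) by (auto simp: zero_nbhd_def)
    ultimately have "v + 0 \<in> S" using that(2) by blast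
    then show "v \<in> S" by simp
  qed
  have "\<exists>V. \<forall>n. (zero_nbhd (V n) \<and> balanced (V n) \<and> (n = 0 \<longrightarrow> V n \<subseteq> W)) \<and>
    (\<forall>u\<in>V (Suc n). \<forall>v\<in>V (Suc n). u + v \<in> V n \<inter> B n)"
  proof (rule dependent_nat_choice)
    have "zero_nbhd W" using W by (auto simp: zero_nbhd_def)
    then obtain V where "zero_nbhd V" "balanced V" "\<forall>u\<in>V. \<forall>v\<in>V. u + v \<in> W"
      using ex_balanced_half by blast
    then show "\<exists>V. zero_nbhd V \<and> balanced V \<and> (0 = 0 \<longrightarrow> V \<subseteq> W)" using subset by blast
  next
    fix V and n :: nat assume "zero_nbhd V \<and> balanced V \<and> (n = 0 \<longrightarrow> V \<subseteq> W)"
    then obtain S where "openin TE S" "0 \<in> S" "S \<subseteq> V" by (auto simp: zero_nbhd_def)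
    then have "zero_nbhd (V \<inter> B n)"
      unfolding zero_nbhd_def using B by (intro exI[of _ "S \<inter> B n"]) auto
    then obtain V' where "zero_nbhd V'" "balanced V'" "\<forall>u\<in>V'. \<forall>v\<in>V'. u + v \<in> V \<inter> B n"
      using ex_balanced_half by blast
    then show "\<exists>V'. (zero_nbhd V' \<and> balanced V' \<and> (Suc n = 0 \<longrightarrow> V' \<subseteq> W)) \<and>
      (\<forall>u\<in>V'. \<forall>v\<in>V'. u + v \<in> V \<inter> B n)" by blast
  qed
  then obtain V where V: "\<And>n. zero_nbhd (V n)" "\<And>n. balanced (V n)" "V 0 \<subseteq> W"
    "\<And>n. \<forall>u\<in>V (Suc n). \<forall>v\<in>V (Suc n). u + v \<in> V n \<inter> B n" by blast
  have "V (Suc n) \<subseteq> B n" for n using subset[OF V(1) V(4)] by blast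
  then have "nbhd_string V" unfolding nbhd_string_def using V base by (meson IntD1 subset_trans)
  then show ?thesis using V(3) by blast
qed

lemma nbhd_string_zero: "nbhd_string V \<Longrightarrow> 0 \<in> V n"
  by (auto simp: nbhd_string_def zero_nbhd_def)

lemma nbhd_string_add: "nbhd_string V \<Longrightarrow> u \<in> V (Suc n) \<Longrightarrow> v \<in> V (Suc n) \<Longrightarrow> u + v \<in> V n"
  by (simp add: nbhd_string_def)

lemma nbhd_string_sm: "nbhd_string V \<Longrightarrow> av a \<le> 1 \<Longrightarrow> v \<in> V n \<Longrightarrow> sm a v \<in> V n"
  by (simp add: nbhd_string_def balanced_def)

lemma nbhd_string_antimono: assumes "nbhd_string V" "m \<le> n" shows "V n \<subseteq> V m"
proof (rule lift_Suc_antimono_le[OF _ assms(2)])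
  show "V (Suc k) \<subseteq> V k" for k
    using nbhd_string_add[OF assms(1) _ nbhd_string_zero[OF assms(1)]] by fastforce
qed

text \<open>Bracketing from the right, the tail after index m lies in \<open>V (Suc m)\<close> and
  so does the term with index m, so their sum lies in \<open>V m\<close>. The bound is independent
  of the number of summands; the induction is on the length of an interval containing S.\<close>

lemma nbhd_string_sum:
  assumes V: "nbhd_string V" and "finite S" and "\<And>i. i \<in> S \<Longrightarrow> m \<le> i \<and> v i \<in> V (Suc i)"
  shows "sum v S \<in> V m"
proof -
  obtain k where k: "S \<subseteq> {m..<m + k}"
  proof -
    obtain K where "\<forall>i\<in>S. i < K" using \<open>finite S\<close> finite_nat_set_iff_bounded by blast
    then show ?thesis using assms(3) by (intro that[of K]) fastforce
  qed
  from assms(3) k show ?thesis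
  proof (induction k arbitrary: m S)
    case 0
    then show ?case using nbhd_string_zero[OF V] by simp
  next
    case (Suc k)
    have fin: "finite S" using Suc.prems(2) finite_subset by blast
    have rest: "sum v (S - {m}) \<in> V (Suc m)"
    proof (rule Suc.IH)
      show "Suc m \<le> i \<and> v i \<in> V (Suc i)" if "i \<in> S - {m}" for i using Suc.prems(1)[of i] that by auto
      show "S - {m} \<subseteq> {Suc m..<Suc m + k}" using Suc.prems(2) by force
    qed
    show ?case
    proof (cases "m \<in> S")
      case True
      then have "v m \<in> V (Suc m)" using Suc.prems(1) by blast
      then have "v m + sum v (S - {m}) \<in> V m" using rest nbhd_string_add[OF V] by blast
      then show ?thesis using True fin by (simp add: sum.remove)
    next
      case False
      then show ?thesis using rest nbhd_string_antimono[OF V, of m "Suc m"] by auto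
    qed
  qed
qed

section \<open>Series of scalar divided differences with small vector coefficients\<close>

definition dd_series :: "(nat \<Rightarrow> 'k list \<Rightarrow> 'k) \<Rightarrow> (nat \<Rightarrow> 'e) \<Rightarrow> 'k list \<Rightarrow> 'e" where
  "dd_series B y xs = (\<Sum>n | B n xs \<noteq> 0. sm (B n xs) (y n))"

text \<open>The index set of the series depends on the list; enlarging it to a common finite set
  allows the values at different lists to be combined.\<close>

lemma dd_series_eq:
  "finite F \<Longrightarrow> {n. B n xs \<noteq> 0} \<subseteq> F \<Longrightarrow> dd_series B y xs = (\<Sum>n\<in>F. sm (B n xs) (y n))"
  unfolding dd_series_def by (rule sum.mono_neutral_left) auto

lemma dd_system_series:
  assumes B: "\<And>n. dd_system (*) (B n)" and fin: "\<And>xs. finite {n. B n xs \<noteq> 0}"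
  shows "dd_system sm (dd_series B v)"
  unfolding dd_system_def
proof (intro allI)
  fix x y zs
  let ?F = "{n. B n (x # zs) \<noteq> 0} \<union> {n. B n (y # zs) \<noteq> 0} \<union> {n. B n (x # y # zs) \<noteq> 0}"
  have F: "finite ?F" using fin by blast
  have "dd_series B v (x # zs) - dd_series B v (y # zs)
    = (\<Sum>n\<in>?F. sm (B n (x # zs)) (v n) - sm (B n (y # zs)) (v n))"
    by (subst (1 2) dd_series_eq[OF F]) (auto simp: sum_subtractf)
  also have "\<dots> = (\<Sum>n\<in>?F. sm (x - y) (sm (B n (x # y # zs)) (v n)))"
    using B by (simp add: sm_diff_left[symmetric] sm_mult[symmetric] dd_system_def)
  also have "\<dots> = sm (x - y) (dd_series B v (x # y # zs))"
    by (subst dd_series_eq[OF F]) (auto simp: sm_sum_right)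
  finally show "dd_series B v (x # zs) - dd_series B v (y # zs) = sm (x - y) (dd_series B v (x # y # zs))" .
qed

lemma dd_symmetric_series:
  assumes "\<And>n. dd_symmetric (B n)" shows "dd_symmetric (dd_series B v)"
  using assms unfolding dd_symmetric_def dd_series_def by simp

text \<open>The first N terms form a finite sum and are continuous; the remaining ones, at the given
  list as well as at nearby ones, add up to an element of \<open>V (k + 2)\<close>. The two tails
  together fall into \<open>V (k + 1)\<close>, as does the change of the finite sum, so the total
  change lies in \<open>V k\<close>.\<close>

lemma dd_continuous_series:
  assumes cont: "\<And>n. dd_continuous av (abs_topology av) (B n)" and fin: "\<And>xs. finite {n. B n xs \<noteq> 0}"
    and V: "nbhd_string V" and y: "\<And>n. y n \<in> V (Suc n)"
    and bd: "\<And>n xs. length xs \<le> Suc n \<Longrightarrow> \<forall>x\<in>set xs. av x \<le> real n + 2 \<Longrightarrow> av (B n xs) \<le> 1"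
  shows "dd_continuous av TE (dd_series B y)"
  unfolding dd_continuous_def
proof (intro allI impI)
  fix xs W assume W: "openin TE W \<and> dd_series B y xs \<in> W"
  let ?S = "dd_series B y"
  obtain k where k: "V k \<subseteq> {v. ?S xs + v \<in> W}"
    using V openin_translate[of W "?S xs"] W by (auto simp: nbhd_string_def)
  \<comment> \<open>For n at least N the bound \<open>bd\<close> then applies to all lists within
    distance 1 of \<open>xs\<close>: they have length at most N and entries of size at most N +
    1.\<close>
  obtain N where N: "k + 2 \<le> N" "length xs \<le> N" "\<And>x. x \<in> set xs \<Longrightarrow> av x \<le> real N"
  proof -
    obtain M where "sum_list (map av xs) \<le> real M" using real_arch_simple by blast
    moreover have "av x \<le> sum_list (map av xs)" if "x \<in> set xs" for x
      by (rule member_le_sum_list) (use that in auto)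
    ultimately have "av x \<le> real M" if "x \<in> set xs" for x using that by force
    then show ?thesis by (intro that[of "k + 2 + length xs + M"]) force+
  qed
  define hd where "hd = (\<lambda>ys. \<Sum>n<N. sm (B n ys) (y n))"
  define tl where "tl = (\<lambda>ys. \<Sum>n\<in>{n. B n ys \<noteq> 0} \<inter> {N..}. sm (B n ys) (y n))"
  have split: "?S ys = hd ys + tl ys" for ys
  proof -
    let ?P = "{n. B n ys \<noteq> 0}"
    have "?S ys = (\<Sum>n\<in>{..<N} \<union> (?P \<inter> {N..}). sm (B n ys) (y n))"
      using fin by (intro dd_series_eq) auto
    also have "\<dots> = hd ys + tl ys"
      unfolding hd_def tl_def using fin by (intro sum.union_disjoint) auto
    finally show ?thesis .
  qed
  have tail: "tl ys \<in> V (k + 2)" if "length ys \<le> N" "\<forall>x\<in>set ys. av x \<le> real N + 2" for ys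
  proof -
    have "tl ys \<in> V N"
      unfolding tl_def
    proof (rule nbhd_string_sum[OF V])
      fix n assume n: "n \<in> {n. B n ys \<noteq> 0} \<inter> {N..}"
      have "av (B n ys) \<le> 1" using n that by (intro bd) force+
      then show "N \<le> n \<and> sm (B n ys) (y n) \<in> V (Suc n)" using n y nbhd_string_sm[OF V] by auto
    qed (use fin in auto)
    then show ?thesis using nbhd_string_antimono[OF V N(1)] by blast
  qed
  have "continuous_map list_topology TE (\<lambda>ys. \<Sum>n\<in>{..<m}. sm (B n ys) (y n))" for m :: nat
    using cont by (induction m)
      (auto simp: dd_continuous_iff_continuous_map intro!: continuous_map_tvs_add continuous_map_tvs_sm)
  then have hd_cont: "dd_continuous av TE hd"
    by (simp add: hd_def dd_continuous_iff_continuous_map)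
  obtain G where G: "openin TE G" "0 \<in> G" "G \<subseteq> V (k + 2)"
    using V unfolding nbhd_string_def zero_nbhd_def by meson
  have "openin TE {v. - hd xs + v \<in> G}" by (rule openin_translate[OF G(1)])
  moreover have "hd xs \<in> {v. - hd xs + v \<in> G}" using G by simp
  ultimately have "\<exists>\<delta>>0. \<forall>ys. list_all2 (\<lambda>x y. av (y - x) < \<delta>) xs ys \<longrightarrow> hd ys \<in> {v. - hd xs + v \<in> G}"
    using hd_cont[unfolded dd_continuous_def, rule_format, of "{v. - hd xs + v \<in> G}" xs] by simp
  then obtain \<delta> where \<delta>: "\<delta> > 0" "\<And>ys. list_all2 (\<lambda>x y. av (y - x) < \<delta>) xs ys \<Longrightarrow> - hd xs + hd ys \<in> G"
    by auto
  show "\<exists>\<delta>>0. \<forall>ys. list_all2 (\<lambda>x y. av (y - x) < \<delta>) xs ys \<longrightarrow> ?S ys \<in> W"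
  proof (intro exI[of _ "min 1 \<delta>"] conjI allI impI)
    fix ys assume close: "list_all2 (\<lambda>x y. av (y - x) < min 1 \<delta>) xs ys"
    have len: "length ys = length xs" using close by (auto dest: list_all2_lengthD)
    have ys: "av v \<le> real N + 2" if v: "v \<in> set ys" for v
    proof -
      obtain i where "i < length ys" "v = ys ! i" using v by (auto simp: in_set_conv_nth)
      then have "av (v - xs ! i) < 1" "xs ! i \<in> set xs"
        using close len by (auto simp: list_all2_conv_all_nth)
      then show ?thesis using N(3)[of "xs ! i"] av_triangle[of "v - xs ! i" "xs ! i"] by simp
    qed
    have "list_all2 (\<lambda>x y. av (y - x) < \<delta>) xs ys" using close by (rule list_all2_mono) simp
    then have h: "- hd xs + hd ys \<in> V (k + 2)" using \<delta>(2) G(3) by blast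
    have t: "tl ys \<in> V (k + 2)" using len N(2) ys by (intro tail) auto
    have "tl xs \<in> V (k + 2)" using N(2,3) by (intro tail) force+
    then have "sm (- 1) (tl xs) \<in> V (k + 2)" by (intro nbhd_string_sm[OF V]) auto
    then have "tl ys + sm (- 1) (tl xs) \<in> V (Suc k)" using t nbhd_string_add[OF V] by simp
    moreover have "- hd xs + hd ys \<in> V (Suc k)" using h nbhd_string_antimono[OF V, of "Suc k" "k + 2"] by auto
    ultimately have "(- hd xs + hd ys) + (tl ys + sm (- 1) (tl xs)) \<in> V k" using nbhd_string_add[OF V] by blast
    then have "?S xs + ((- hd xs + hd ys) + (tl ys + sm (- 1) (tl xs))) \<in> W" using k by blast
    moreover have "?S xs + ((- hd xs + hd ys) + (tl ys + sm (- 1) (tl xs))) = ?S ys"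
      by (simp add: split sm_minus_left)
    ultimately show "?S ys \<in> W" by simp
  qed (use \<delta> in auto)
qed

end

lemma (in valued_field) dd_bump_bounded_upto:
  assumes "dd_bump t r D"
  shows "\<exists>C\<ge>0. \<forall>xs. length xs \<le> n \<and> (\<forall>x\<in>set xs. av x \<le> M) \<longrightarrow> av (D xs) \<le> C"
proof (induction n)
  case 0
  show ?case using assms by (intro exI[of _ 0]) (auto simp: dd_bump_def)
next
  case (Suc n)
  then obtain C where C: "C \<ge> 0" "\<forall>xs. length xs \<le> n \<and> (\<forall>x\<in>set xs. av x \<le> M) \<longrightarrow> av (D xs) \<le> C"
    by blast
  obtain C' where "\<forall>xs. length xs = Suc n \<and> (\<forall>x\<in>set xs. av x \<le> M) \<longrightarrow> av (D xs) \<le> C'"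
    using assms unfolding dd_bump_def by blast
  with C show ?case by (intro exI[of _ "max C C'"]) (auto simp: le_Suc_eq le_max_iff_disj)
qed

lemma (in valued_field) dd_bump_scaled:
  assumes "dd_bump t r D"
  shows "\<exists>a. a \<noteq> 0 \<and> (\<forall>xs. length xs \<le> n \<and> (\<forall>x\<in>set xs. av x \<le> M) \<longrightarrow> av (a * D xs) \<le> 1)"
proof -
  obtain C where C: "C \<ge> 0" "\<And>xs. length xs \<le> n \<Longrightarrow> \<forall>x\<in>set xs. av x \<le> M \<Longrightarrow> av (D xs) \<le> C"
    using dd_bump_bounded_upto[OF assms, of n M] by blast
  obtain a where a: "a \<noteq> 0" "av a < 1 / (C + 1)" using ex_small[of "1 / (C + 1)"] C(1) by auto
  have "av (a * D xs) \<le> 1" if "length xs \<le> n" "\<forall>x\<in>set xs. av x \<le> M" for xs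
  proof -
    have "av (a * D xs) \<le> 1 / (C + 1) * C"
      unfolding av_mult using a C that by (intro mult_mono) auto
    also have "\<dots> \<le> 1" using C(1) by simp
    finally show ?thesis .
  qed
  with a(1) show ?thesis by blast
qed

section \<open>A smooth curve that detects a set which is not open\<close>

context valued_tvs
begin

text \<open>The supports of the bumps around \<open>\<pi> ^ n\<close> may overlap, but the bump at \<open>\<pi> ^ n\<close> vanishes at
  \<open>\<pi> ^ m\<close> for \<open>m \<noteq> n\<close>, at \<open>0\<close>, and each point lies in finitely many supports only.\<close>

lemma special_curve:
  assumes bump: "\<And>t r. r > 0 \<Longrightarrow> \<exists>D. dd_bump t r D" and metr: "metrizable_space TE"
    and U: "openin TE U" "x \<in> U" and A: "\<And>W. openin TE W \<Longrightarrow> x \<in> W \<Longrightarrow> \<not> W \<subseteq> A"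
  shows "\<exists>c. smooth_curve av sm TE c \<and> range c \<subseteq> U \<and> c 0 = x \<and> (\<forall>\<epsilon>>0. \<exists>s. av s < \<epsilon> \<and> c s \<notin> A)"
proof -
  obtain \<pi> where \<pi>: "\<pi> \<noteq> 0" "av \<pi> < 1" using ex_contraction by blast
  define \<rho> where "\<rho> = av \<pi>"
  have \<rho>: "0 < \<rho>" "\<rho> < 1" using \<pi> by (auto simp: \<rho>_def)
  \<comment> \<open>This is the gap between \<rho>^n and \<rho>^(n + 1), so later points of the
    sequence keep distance at least \<open>r n\<close> from \<pi>^n; earlier ones do so because r
    decreases. As \<open>r n\<close> is below \<rho>^n, the point 0 is avoided too.\<close>
  define r where "r n = \<rho> ^ n * (1 - \<rho>)" for n
  have r: "r n > 0" "r n < \<rho> ^ n" for n using \<rho> by (auto simp: r_def)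
  have r_le: "r n \<le> r m" if "m \<le> n" for m n
    using that \<rho> by (auto simp: r_def intro!: mult_right_mono power_decreasing)
  have sep: "r n \<le> av (\<pi> ^ m - \<pi> ^ n)" if "m \<noteq> n" for m n
  proof -
    have *: "r k \<le> av (\<pi> ^ k - \<pi> ^ l)" if "k < l" for k l
    proof -
      have "\<rho> ^ l \<le> \<rho> ^ Suc k" using that \<rho> by (intro power_decreasing) auto
      then have "r k \<le> \<rho> ^ k - \<rho> ^ l" by (simp add: r_def algebra_simps)
      also have "\<dots> \<le> av (\<pi> ^ k - \<pi> ^ l)"
        using av_triangle[of "\<pi> ^ k - \<pi> ^ l" "\<pi> ^ l"] by (simp add: \<rho>_def av_power)
      finally show ?thesis .
    qed
    show ?thesis
    proof (cases "m < n")
      case True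
      then show ?thesis using *[OF True] r_le[of m n] by simp
    next
      case False
      then show ?thesis using *[of n m] that by (simp add: av_diff_commute)
    qed
  qed
  have fin_supp: "finite {n. av (x - \<pi> ^ n) \<le> r n}" for x
  proof (cases "x = 0")
    case True
    then have "{n. av (x - \<pi> ^ n) \<le> r n} = {}" using r(2) by (auto simp: av_power \<rho>_def not_le)
    then show ?thesis by simp
  next
    case False
    obtain N where N: "\<rho> ^ N < av x / 2" using real_arch_pow_inv[of "av x / 2" \<rho>] False \<rho> by auto
    have "n < N" if "av (x - \<pi> ^ n) \<le> r n" for n
    proof (rule ccontr)
      assume "\<not> n < N"
      then have "\<rho> ^ n \<le> \<rho> ^ N" using \<rho> by (intro power_decreasing) auto
      moreover have "av x \<le> av (x - \<pi> ^ n) + \<rho> ^ n"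
        using av_triangle[of "x - \<pi> ^ n" "\<pi> ^ n"] by (simp add: av_power \<rho>_def)
      ultimately show False using that N r(2)[of n] by linarith
    qed
    then have "{n. av (x - \<pi> ^ n) \<le> r n} \<subseteq> {..<N}" by blast
    then show ?thesis by (rule finite_subset) simp
  qed
  have "\<forall>n. \<exists>D. dd_bump (\<pi> ^ n) (r n) D" using bump r by blast
  then obtain D where D: "\<And>n. dd_bump (\<pi> ^ n) (r n) (D n)" by metis
  have "\<forall>n. \<exists>a. a \<noteq> 0 \<and> (\<forall>xs. length xs \<le> Suc n \<and> (\<forall>x\<in>set xs. av x \<le> real n + 2) \<longrightarrow> av (a * D n xs) \<le> 1)"
    using dd_bump_scaled[OF D] by blast
  then obtain a where a0: "\<And>n. a n \<noteq> 0"
    and a1: "\<And>n xs. length xs \<le> Suc n \<Longrightarrow> \<forall>x\<in>set xs. av x \<le> real n + 2 \<Longrightarrow> av (a n * D n xs) \<le> 1"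
    by metis
  define B where "B n xs = a n * D n xs" for n xs
  have B_sys: "dd_system (*) (B n)" for n
    using D[of n] by (auto simp: dd_bump_def dd_system_def B_def right_diff_distrib[symmetric] mult.left_commute)
  have B_cont: "dd_continuous av (abs_topology av) (B n)" for n
    using D[of n] unfolding dd_bump_def B_def
    by (simp add: dd_continuous_iff_continuous_map continuous_map_abs_mult)
  have B_zero: "B n [s] = 0" if "av (s - \<pi> ^ n) \<ge> r n" for n s
    using D[of n] that by (simp add: dd_bump_def B_def)
  have B_fin: "finite {n. B n xs \<noteq> 0}" for xs
  proof (rule finite_subset)
    have "B n xs = 0" if "\<forall>x\<in>set xs. av (x - \<pi> ^ n) > r n" for n
      by (rule dd_vanishes_off_support[OF B_sys B_cont _ _ that])
         (use D[of n] in \<open>auto simp: B_def dd_bump_def\<close>)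
    then show "{n. B n xs \<noteq> 0} \<subseteq> (\<Union>x\<in>set xs. {n. av (x - \<pi> ^ n) \<le> r n})"
      by (force simp: not_less)
    show "finite (\<Union>x\<in>set xs. {n. av (x - \<pi> ^ n) \<le> r n})" using fin_supp by blast
  qed
  have "openin TE {v. x + v \<in> U}" by (rule openin_translate[OF U(1)])
  then obtain V where V: "nbhd_string V" "V 0 \<subseteq> {v. x + v \<in> U}"
    using ex_nbhd_string[OF metr, of "{v. x + v \<in> U}"] U(2) by auto
  \<comment> \<open>Closeness is measured after division by \<open>a n\<close>: the curve multiplies
    the quotient by a bump of height \<open>a n\<close>, which restores \<open>z n - x\<close>.
    Translating and dilating a neighbourhood of 0 gives a neighbourhood of x, which A cannot
    contain.\<close>
  have "\<exists>z. z \<notin> A \<and> sm (1 / a n) (z - x) \<in> V (Suc n)" for n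
  proof -
    obtain G where G: "openin TE G" "0 \<in> G" "G \<subseteq> V (Suc n)"
      using V(1) unfolding nbhd_string_def zero_nbhd_def by meson
    have "openin TE {z. - x + z \<in> {v. sm (1 / a n) v \<in> G}}"
      by (intro openin_translate openin_dilate G)
    moreover have "x \<in> {z. - x + z \<in> {v. sm (1 / a n) v \<in> G}}" using G by simp
    ultimately obtain z where "z \<in> {z. - x + z \<in> {v. sm (1 / a n) v \<in> G}}" "z \<notin> A" using A by blast
    then show ?thesis using G(3) by auto
  qed
  then obtain z where z: "\<And>n. z n \<notin> A" "\<And>n. sm (1 / a n) (z n - x) \<in> V (Suc n)" by metis
  define y where "y n = sm (1 / a n) (z n - x)" for n
  have y: "y n \<in> V (Suc n)" "sm (a n) (y n) = z n - x" for n
    using z a0[of n] by (auto simp: y_def sm_mult[symmetric])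
  \<comment> \<open>The constant x contributes to lists of length 1 only, since the higher divided
    differences of a constant vanish.\<close>
  define E where "E xs = dd_series B y xs + (if length xs = 1 then x else 0)" for xs
  have "dd_system sm E"
    using dd_system_series[OF B_sys B_fin, of y] by (simp add: dd_system_def E_def)
  moreover have "dd_symmetric E"
    using dd_symmetric_series[of B y, OF dd_symmetric_scalar[OF B_sys B_cont]]
    by (simp add: dd_symmetric_def E_def)
  moreover have "dd_continuous av TE E"
  proof -
    have "dd_continuous av TE (\<lambda>xs. if length xs = 1 then x else 0)"
      unfolding dd_continuous_def by (auto intro!: exI[of _ 1] dest: list_all2_lengthD)
    moreover have "dd_continuous av TE (dd_series B y)"
      by (rule dd_continuous_series[OF B_cont B_fin V(1) y(1)]) (use a1 in \<open>simp add: B_def\<close>)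
    ultimately show ?thesis
      unfolding E_def by (simp add: dd_continuous_iff_continuous_map continuous_map_tvs_add)
  qed
  ultimately have smooth: "smooth_curve av sm TE (\<lambda>s. E [s])" by (rule smooth_curve_of_dd_system)
  have "E [s] \<in> U" for s
  proof -
    have "dd_series B y [s] \<in> V 0"
      unfolding dd_series_def
    proof (rule nbhd_string_sum[OF V(1) B_fin])
      fix n assume n: "n \<in> {n. B n [s] \<noteq> 0}"
      have "av (s - \<pi> ^ n) < r n" using B_zero[of n s] n by force
      moreover have "\<rho> ^ n \<le> 1" using \<rho> by (simp add: power_le_one)
      moreover have "av s \<le> av (s - \<pi> ^ n) + \<rho> ^ n"
        using av_triangle[of "s - \<pi> ^ n" "\<pi> ^ n"] by (simp add: av_power \<rho>_def)
      \<comment> \<open>A parameter in the support of the n-th bump has size below 2, so the bound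
        on scaled bumps holds for every contributing n, including n = 0. This keeps the whole curve
        inside U and not only its part near 0.\<close>
      ultimately have "av s \<le> real n + 2" using r(2)[of n] by linarith
      then have "av (B n [s]) \<le> 1" unfolding B_def by (intro a1) auto
      then show "0 \<le> n \<and> sm (B n [s]) (y n) \<in> V (Suc n)"
        using y(1) nbhd_string_sm[OF V(1)] by blast
    qed
    then show ?thesis using V(2) by (auto simp: E_def add.commute)
  qed
  moreover have "E [0] = x"
  proof -
    have "B n [0] = 0" for n
      by (rule B_zero) (use r(2)[of n] in \<open>simp add: av_power \<rho>_def\<close>)
    then show ?thesis by (simp add: E_def dd_series_def)
  qed
  moreover have "\<exists>s. av s < \<epsilon> \<and> E [s] \<notin> A" if \<epsilon>: "\<epsilon> > 0" for \<epsilon>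
  proof -
    obtain n where n: "\<rho> ^ n < \<epsilon>" using real_arch_pow_inv[OF \<epsilon> \<rho>(2)] by blast
    have "B m [\<pi> ^ n] = 0" if "m \<noteq> n" for m using sep[of n m] that by (intro B_zero) auto
    then have "dd_series B y [\<pi> ^ n] = sm (B n [\<pi> ^ n]) (y n)"
      by (subst dd_series_eq[of "{n}"]) auto
    also have "B n [\<pi> ^ n] = a n" using D[of n] by (simp add: B_def dd_bump_def)
    finally have "E [\<pi> ^ n] = z n" by (simp add: E_def y)
    then show ?thesis using n z(1) by (intro exI[of _ "\<pi> ^ n"]) (auto simp: av_power \<rho>_def)
  qed
  ultimately show ?thesis using smooth by (intro exI[of _ "\<lambda>s. E [s]"]) auto
qed

lemma openin_if_smooth_preimages_open:
  assumes bump: "\<And>t r. r > 0 \<Longrightarrow> \<exists>D. dd_bump t r D" and metr: "metrizable_space TE"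
    and U: "openin TE U" and A: "A \<subseteq> U"
    and pre: "\<And>c. smooth_curve av sm TE c \<Longrightarrow> range c \<subseteq> U \<Longrightarrow> openin (abs_topology av) (c -` A)"
  shows "openin TE A"
proof (subst openin_subopen, intro ballI)
  fix x assume x: "x \<in> A"
  show "\<exists>W. openin TE W \<and> x \<in> W \<and> W \<subseteq> A"
  proof (rule ccontr)
    assume "\<not> ?thesis"
    then obtain c where c: "smooth_curve av sm TE c" "range c \<subseteq> U" "c 0 = x"
      "\<And>\<epsilon>. \<epsilon> > 0 \<Longrightarrow> \<exists>s. av s < \<epsilon> \<and> c s \<notin> A"
      using special_curve[OF bump metr U, of x A] x A by blast
    have "0 \<in> c -` A" using c(3) x by simp
    then obtain \<epsilon> where "\<epsilon> > 0" "\<forall>s. av (s - 0) < \<epsilon> \<longrightarrow> s \<in> c -` A"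
      using pre[OF c(1,2)] unfolding openin_abs_topology by meson
    then show False using c(4)[of \<epsilon>] by auto
  qed
qed

end

section \<open>The final topology\<close>

lemma openin_final_topology:
  "openin (final_topology T S F) A \<longleftrightarrow> A \<subseteq> S \<and> (\<forall>c\<in>F. openin T (c -` A \<inter> topspace T))"
proof -
  have "istopology (\<lambda>A. A \<subseteq> S \<and> (\<forall>c\<in>F. openin T (c -` A \<inter> topspace T)))"
    unfolding istopology_def
  proof (intro conjI allI impI ballI)
    fix A B c
    assume "A \<subseteq> S \<and> (\<forall>c\<in>F. openin T (c -` A \<inter> topspace T))"
      "B \<subseteq> S \<and> (\<forall>c\<in>F. openin T (c -` B \<inter> topspace T))" "c \<in> F"
    then have "openin T ((c -` A \<inter> topspace T) \<inter> (c -` B \<inter> topspace T))" by blast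
    moreover have "(c -` A \<inter> topspace T) \<inter> (c -` B \<inter> topspace T) = c -` (A \<inter> B) \<inter> topspace T" by blast
    ultimately show "openin T (c -` (A \<inter> B) \<inter> topspace T)" by simp
  next
    fix \<K> c
    assume \<K>: "\<forall>K\<in>\<K>. K \<subseteq> S \<and> (\<forall>c\<in>F. openin T (c -` K \<inter> topspace T))" and c: "c \<in> F"
    have "openin T (\<Union>K\<in>\<K>. c -` K \<inter> topspace T)" using \<K> c by blast
    moreover have "(\<Union>K\<in>\<K>. c -` K \<inter> topspace T) = c -` \<Union>\<K> \<inter> topspace T" by blast
    ultimately show "openin T (c -` \<Union>\<K> \<inter> topspace T)" by simp
  qed blast+
  then show ?thesis unfolding final_topology_def by (subst topology_inverse') (assumption, rule refl)
qed

theorem theorem11p3: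
  fixes av :: "'k::field \<Rightarrow> real"
    and sm :: "'k \<Rightarrow> 'e::ab_group_add \<Rightarrow> 'e"
    and TE :: "'e topology"
    and U :: "'e set"
  assumes "abs_value av" and "nontrivial_abs av"
    and "is_real_abs av \<or> ultrametric_abs av"
    and "tvs av sm TE" and "Hausdorff_space TE" and "metrizable_space TE"
    and "openin TE U" and "U \<noteq> {}"
  shows "subtopology TE U =
           final_topology (abs_topology av) U {c. smooth_curve av sm TE c \<and> range c \<subseteq> U}
       \<and> (\<forall>(Z :: 'z topology) f. f ` U \<subseteq> topspace Z \<longrightarrow>
            (continuous_map (subtopology TE U) Z f \<longleftrightarrow>
              (\<forall>c. smooth_curve av sm TE c \<and> range c \<subseteq> U \<longrightarrow>
                   continuous_map (abs_topology av) Z (f \<circ> c))))"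
proof -
  interpret valued_tvs av sm TE using assms by unfold_locales
  have bump: "\<exists>D. dd_bump t r D" if "r > 0" for t r
    using assms(3) real_dd_bump ultrametric_dd_bump that by blast
  have cont: "continuous_map (abs_topology av) (subtopology TE U) c"
    if "smooth_curve av sm TE c" "range c \<subseteq> U" for c
    using continuous_map_smooth_curve[OF that(1)] that(2) by (auto simp: continuous_map_in_subtopology)
  \<comment> \<open>The right-hand side describes the open sets of the final topology, which is (a);
    applied to the preimages of open sets under f, it also gives the harder direction of
    (b).\<close>
  have open_iff: "openin (subtopology TE U) A \<longleftrightarrow> A \<subseteq> U \<and>
      (\<forall>c. smooth_curve av sm TE c \<and> range c \<subseteq> U \<longrightarrow> openin (abs_topology av) (c -` A))" for A
  proof
    assume A: "openin (subtopology TE U) A"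
    have "openin (abs_topology av) (c -` A)" if "smooth_curve av sm TE c" "range c \<subseteq> U" for c
      using openin_continuous_map_preimage[OF cont[OF that] A] by (simp add: vimage_def)
    moreover have "A \<subseteq> U" using openin_subset[OF A] by simp
    ultimately show "A \<subseteq> U \<and>
      (\<forall>c. smooth_curve av sm TE c \<and> range c \<subseteq> U \<longrightarrow> openin (abs_topology av) (c -` A))" by blast
  next
    assume A: "A \<subseteq> U \<and>
      (\<forall>c. smooth_curve av sm TE c \<and> range c \<subseteq> U \<longrightarrow> openin (abs_topology av) (c -` A))"
    then have "openin TE A"
      by (intro openin_if_smooth_preimages_open[OF bump assms(6,7)]) auto
    then show "openin (subtopology TE U) A" using A assms(7) by (simp add: openin_open_subtopology)
  qed
  have "subtopology TE U =
      final_topology (abs_topology av) U {c. smooth_curve av sm TE c \<and> range c \<subseteq> U}"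
    unfolding topology_eq openin_final_topology open_iff by auto
  moreover have "continuous_map (subtopology TE U) Z f \<longleftrightarrow>
      (\<forall>c. smooth_curve av sm TE c \<and> range c \<subseteq> U \<longrightarrow> continuous_map (abs_topology av) Z (f \<circ> c))"
    if f: "f ` U \<subseteq> topspace Z" for Z :: "'z topology" and f
  proof
    assume "continuous_map (subtopology TE U) Z f"
    then show "\<forall>c. smooth_curve av sm TE c \<and> range c \<subseteq> U \<longrightarrow> continuous_map (abs_topology av) Z (f \<circ> c)"
      using continuous_map_compose[OF cont] by blast
  next
    assume comp: "\<forall>c. smooth_curve av sm TE c \<and> range c \<subseteq> U \<longrightarrow> continuous_map (abs_topology av) Z (f \<circ> c)"
    show "continuous_map (subtopology TE U) Z f"
      unfolding continuous_map_def
    proof (intro conjI allI impI)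
      show "f \<in> topspace (subtopology TE U) \<rightarrow> topspace Z" using f by auto
      fix G assume G: "openin Z G"
      have "openin (abs_topology av) (c -` {x \<in> U. f x \<in> G})"
        if c: "smooth_curve av sm TE c" "range c \<subseteq> U" for c
      proof -
        have "openin (abs_topology av) {s \<in> topspace (abs_topology av). (f \<circ> c) s \<in> G}"
          by (rule openin_continuous_map_preimage[OF _ G]) (use comp c in blast)
        moreover have "{s \<in> topspace (abs_topology av). (f \<circ> c) s \<in> G} = c -` {x \<in> U. f x \<in> G}"
          using c(2) by auto
        ultimately show ?thesis by simp
      qed
      then have "openin (subtopology TE U) {x \<in> U. f x \<in> G}" unfolding open_iff by auto
      then show "openin (subtopology TE U) {x \<in> topspace (subtopology TE U). f x \<in> G}" by simp
    qed
  qed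
  ultimately show ?thesis by blast
qed

end
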